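(* Let $0\le s\le n-1$, $A\in M_{s+1,n-s}$, and let $\mathcal L=\{(x,\tilde xA)\mid x\in\mathbb R^s\}\subset\mathbb R^n$, where $\tilde x=(1,x)$. If either (a) all the columns of $A$ are rational multiples of one column, or (b) all the rows of $A$ are rational multiples of one row, then $$\omega(\mathcal L)=\max\big(\omega(A),n\big).$$
   Context: $M_{m,\ell}$ is the space of real $m\times\ell$ matrices; $x$ and $\tilde x$ are row vectors. For $A\in M_{m,\ell}$, $\omega(A)$ is the supremum of $v>0$ for which there are infinitely many $q\in\mathbb Z^\ell$ with $\|Aq+p\|<\|q\|^{-v}$ for some $p\in\mathbb Z^m$. For a row vector $y\in\mathbb R^n$, $\omega(y)$ is $\omega$ of $y$ viewed as a $1\times n$ matrix. For a Borel measure $\mu$ on $\mathbb R^n$, $\omega(\mu)=\sup\{v\mid\mu(\{y\mid\omega(y)>v\})>0\}$, and $\omega(\mathcal L)$ is $\omega$ of Lebesgue measure on $\mathcal L$ (e.g. the pushforward of Lebesgue measure on $\mathbb R^s$ under $x\mapsto(x,\tilde xA)$). *)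

theory Defs
  imports "HOL-Analysis.Analysis" "HOL-Probability.Probability"
begin

text \<open>Vectors in R^k are represented as functions nat => real, only the entries
  with index < k being relevant; an m x l matrix is a function nat => nat => real
  with entries A i j for i < m, j < l.\<close>

definition supnorm :: "nat \<Rightarrow> (nat \<Rightarrow> real) \<Rightarrow> real" where
  "supnorm k x = Max ((\<lambda>i. \<bar>x i\<bar>) ` {..<k})"

definition omega_mat :: "nat \<Rightarrow> nat \<Rightarrow> (nat \<Rightarrow> nat \<Rightarrow> real) \<Rightarrow> ereal" where
  "omega_mat m l A = Sup {ereal v | v. v > 0 \<and>
     infinite {q :: nat \<Rightarrow> int. (\<forall>j\<ge>l. q j = 0) \<and>
       (\<exists>p :: nat \<Rightarrow> int.
          supnorm m (\<lambda>i. (\<Sum>j<l. A i j * of_int (q j)) + of_int (p i))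
            < supnorm l (\<lambda>j. of_int (q j)) powr (- v))}}"

definition omega_vec :: "nat \<Rightarrow> (nat \<Rightarrow> real) \<Rightarrow> ereal" where
  "omega_vec n y = omega_mat 1 n (\<lambda>i j. y j)"

definition euclid :: "nat \<Rightarrow> (nat \<Rightarrow> real) measure" where
  "euclid k = PiM {..<k} (\<lambda>_. lborel)"

definition omega_measure :: "nat \<Rightarrow> (nat \<Rightarrow> real) measure \<Rightarrow> ereal" where
  "omega_measure n \<mu> = Sup {ereal v | v. emeasure \<mu> {y \<in> space \<mu>. omega_vec n y > ereal v} > 0}"

text \<open>The parametrization x |-> (x, x~ A) of L, x~ = (1,x), A an (s+1) x (n-s) matrix.\<close>
definition Lmap :: "nat \<Rightarrow> nat \<Rightarrow> (nat \<Rightarrow> nat \<Rightarrow> real) \<Rightarrow> (nat \<Rightarrow> real) \<Rightarrow> (nat \<Rightarrow> real)" where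
  "Lmap s n A x = restrict (\<lambda>j. if j < s then x j
       else A 0 (j - s) + (\<Sum>i<s. x i * A (Suc i) (j - s))) {..<n}"

definition L_measure :: "nat \<Rightarrow> nat \<Rightarrow> (nat \<Rightarrow> nat \<Rightarrow> real) \<Rightarrow> (nat \<Rightarrow> real) measure" where
  "L_measure s n A = distr (euclid s) (euclid n) (Lmap s n A)"

end

theory Submission
  imports Defs
begin

text \<open>
  For \<open>q = (q\<^sub>1, q\<^sub>2)\<close> the value of \<open>(x, x~ A)\<close> at \<open>q\<close>, shifted by an integer \<open>p\<close>, equals
  \<open>x~ w\<close> with \<open>w = A q\<^sub>2 + (p, q\<^sub>1)\<close>. A good approximation \<open>w\<close> for \<open>A\<close> therefore gives a good
  approximation for every point of the subspace; with Dirichlet's theorem this is the lower bound.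

  For the upper bound fix \<open>v > u > max (\<omega>(A), n)\<close>. On a bounded box the slab \<open>|x~ w| < |q|\<^sup>-\<^sup>v\<close> has
  measure at most a constant times \<open>|q|\<^sup>-\<^sup>v / |w|\<close>. The \<open>w\<close> bounded away from \<open>0\<close> contribute at most a
  constant times \<open>|q|\<^sup>-\<^sup>v\<close> for each \<open>q\<close> after summing over \<open>p\<close>, and this is summable because \<open>v > n\<close>.
  Small \<open>w\<close> satisfy \<open>|w| \<ge> c |q\<^sub>2|\<^sup>-\<^sup>u\<close>, and no general nondivergence argument is needed for them:
  if the rows of \<open>A\<close> are proportional to a rational vector \<open>r\<close>, then small \<open>w\<close> are multiples of \<open>r\<close>,
  so that \<open>|x~ w|\<close> is comparable to \<open>|w|\<close> whenever \<open>x~ r \<noteq> 0\<close>;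
  if the columns are proportional, then either there are two of them and \<open>\<omega>(A) = \<infinity>\<close>, or there is only one
  column \<open>a\<close>. In that case the integers \<open>m\<close> for which \<open>a m\<close> is within \<open>2\<^sup>-\<^sup>j\<close> of an integer vector are
  separated by gaps of order \<open>2\<close> to the power \<open>j / u\<close>, and since \<open>v > u\<close> the sum over \<open>j\<close> and \<open>m\<close>
  of the measures converges.
\<close>

subsection \<open>Integer vectors and approximation exponents\<close>

lemma supnorm_less_iff: "0 < k \<Longrightarrow> supnorm k x < c \<longleftrightarrow> (\<forall>i<k. \<bar>x i\<bar> < c)"
  unfolding supnorm_def by (subst Max_less_iff) auto

lemma supnorm_le_iff: "0 < k \<Longrightarrow> supnorm k x \<le> c \<longleftrightarrow> (\<forall>i<k. \<bar>x i\<bar> \<le> c)"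
  unfolding supnorm_def by (subst Max_le_iff) auto

lemma abs_le_supnorm: "i < k \<Longrightarrow> \<bar>x i\<bar> \<le> supnorm k x"
  unfolding supnorm_def by (intro Max_ge) auto

lemma supnorm_nonneg: "0 < k \<Longrightarrow> 0 \<le> supnorm k x"
  using abs_le_supnorm[of 0 k x] by linarith

lemma supnorm_attained: "0 < k \<Longrightarrow> \<exists>i<k. supnorm k x = \<bar>x i\<bar>"
  unfolding supnorm_def using Max_in[of "(\<lambda>i. \<bar>x i\<bar>) ` {..<k}"] by fastforce

lemma supnorm_1: "supnorm 1 x = \<bar>x 0\<bar>"
  by (simp add: supnorm_def lessThan_Suc)

lemma supnorm_scale: "0 < k \<Longrightarrow> supnorm k (\<lambda>i. c * x i) = \<bar>c\<bar> * supnorm k x"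
proof (rule antisym)
  assume k: "0 < k"
  show "supnorm k (\<lambda>i. c * x i) \<le> \<bar>c\<bar> * supnorm k x"
    using k by (auto simp: supnorm_le_iff abs_mult abs_le_supnorm intro!: mult_left_mono)
  obtain i where "i < k" "supnorm k x = \<bar>x i\<bar>" using supnorm_attained[OF k] by blast
  then show "\<bar>c\<bar> * supnorm k x \<le> supnorm k (\<lambda>i. c * x i)"
    using abs_le_supnorm[of i k "\<lambda>i. c * x i"] by (simp add: abs_mult)
qed

definition int_vecs :: "nat \<Rightarrow> (nat \<Rightarrow> int) set" where
  "int_vecs l = {q. \<forall>j\<ge>l. q j = 0}"

abbreviation hgt :: "nat \<Rightarrow> (nat \<Rightarrow> int) \<Rightarrow> real" where
  "hgt l q \<equiv> supnorm l (\<lambda>j. of_int (q j))"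

definition err :: "nat \<Rightarrow> (nat \<Rightarrow> nat \<Rightarrow> real) \<Rightarrow> (nat \<Rightarrow> int) \<Rightarrow> (nat \<Rightarrow> int) \<Rightarrow> nat \<Rightarrow> real" where
  "err l A q p = (\<lambda>i. (\<Sum>j<l. A i j * of_int (q j)) + of_int (p i))"

definition approx_set :: "nat \<Rightarrow> nat \<Rightarrow> (nat \<Rightarrow> nat \<Rightarrow> real) \<Rightarrow> real \<Rightarrow> (nat \<Rightarrow> int) set" where
  "approx_set m l A v = {q \<in> int_vecs l. \<exists>p. supnorm m (err l A q p) < hgt l q powr (- v)}"

lemma omega_mat_eq: "omega_mat m l A = Sup {ereal v | v. v > 0 \<and> infinite (approx_set m l A v)}"
  unfolding omega_mat_def approx_set_def int_vecs_def err_def by simp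

lemma finite_int_vecs_bounded:
  assumes "0 < l"
  shows "finite {q \<in> int_vecs l. hgt l q \<le> B}"
proof (rule finite_subset)
  let ?f = "\<lambda>g j. if j < l then g j else (0::int)"
  let ?S = "PiE {..<l} (\<lambda>_. {\<lceil>- B\<rceil>..\<lfloor>B\<rfloor>})"
  show "finite (?f ` ?S)"
    by (intro finite_imageI finite_PiE) auto
  show "{q \<in> int_vecs l. hgt l q \<le> B} \<subseteq> ?f ` ?S"
  proof
    fix q assume "q \<in> {q \<in> int_vecs l. hgt l q \<le> B}"
    then have q: "\<And>j. j \<ge> l \<Longrightarrow> q j = 0" "\<And>j. j < l \<Longrightarrow> \<bar>of_int (q j)\<bar> \<le> B"
      using assms by (auto simp: int_vecs_def supnorm_le_iff)
    have "restrict q {..<l} \<in> ?S"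
    proof (rule restrict_PiE_iff[THEN iffD2], rule ballI)
      fix j assume "j \<in> {..<l}"
      then have "\<bar>real_of_int (q j)\<bar> \<le> B" using q(2) by simp
      then show "q j \<in> {\<lceil>- B\<rceil>..\<lfloor>B\<rfloor>}" by (simp add: le_floor_iff ceiling_le_iff abs_le_iff minus_le_iff)
    qed
    moreover have "q = ?f (restrict q {..<l})"
      using q(1) by (auto simp: fun_eq_iff not_less)
    ultimately show "q \<in> ?f ` ?S" by blast
  qed
qed

lemma hgt_ge_1:
  assumes "q \<in> int_vecs l" "q \<noteq> (\<lambda>_. 0)"
  shows "1 \<le> hgt l q"
proof -
  obtain j where j: "q j \<noteq> 0" using assms(2) by auto
  then have "j < l" using assms(1) by (auto simp: int_vecs_def not_le[symmetric])
  then have "\<bar>of_int (q j)\<bar> \<le> hgt l q" by (rule abs_le_supnorm)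
  moreover have "1 \<le> \<bar>real_of_int (q j)\<bar>" using j by linarith
  ultimately show ?thesis by linarith
qed

lemma hgt_zero: "0 < l \<Longrightarrow> hgt l (\<lambda>_. 0) = 0"
  using supnorm_attained[of l "\<lambda>_. 0"] by auto

text \<open>The zero vector is excluded because \<open>0 powr (- v) = 0\<close>.\<close>
lemma approx_set_nonzero:
  assumes "0 < m" "0 < l" "q \<in> approx_set m l A v"
  shows "q \<noteq> (\<lambda>_. 0)"
proof
  assume "q = (\<lambda>_. 0)"
  then obtain p where "supnorm m (err l A q p) < 0"
    using assms hgt_zero[of l] by (auto simp: approx_set_def)
  then show False using supnorm_nonneg[OF assms(1), of "err l A q p"] by linarith
qed

lemma approx_set_antimono:
  assumes "0 < m" "0 < l" "v \<le> v'"
  shows "approx_set m l A v' \<subseteq> approx_set m l A v"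
proof
  fix q assume q: "q \<in> approx_set m l A v'"
  then have "1 \<le> hgt l q"
    using approx_set_nonzero[OF assms(1,2) q] by (auto intro: hgt_ge_1 simp: approx_set_def)
  then have "hgt l q powr (- v') \<le> hgt l q powr (- v)"
    using assms(3) by (intro powr_mono) auto
  then show "q \<in> approx_set m l A v" using q unfolding approx_set_def
    by (blast intro: less_le_trans)
qed

text \<open>A number strictly below a supremum lies below one of its members. With
  \<open>0 \<le> v\<close> every exponent above \<open>v\<close> is positive, hence admissible in
  the supremum.\<close>

lemma omega_mat_less_iff:
  assumes "0 < m" "0 < l" "0 \<le> v"
  shows "ereal v < omega_mat m l A \<longleftrightarrow> (\<exists>v'>v. infinite (approx_set m l A v'))"
proof
  assume "ereal v < omega_mat m l A"
  then show "\<exists>v'>v. infinite (approx_set m l A v')"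
    unfolding omega_mat_eq less_Sup_iff by auto
next
  assume "\<exists>v'>v. infinite (approx_set m l A v')"
  then obtain v' where "v < v'" "infinite (approx_set m l A v')" by blast
  then show "ereal v < omega_mat m l A"
    using assms(3) unfolding omega_mat_eq less_Sup_iff by (intro bexI[of _ "ereal v'"]) auto
qed

lemma omega_mat_geI:
  assumes "0 < v" "infinite (approx_set m l A v)"
  shows "ereal v \<le> omega_mat m l A"
  unfolding omega_mat_eq by (intro Sup_upper) (use assms in auto)

text \<open>An exact integer relation is counted infinitely often through its multiples.\<close>
lemma infinite_approx_set_of_relation:
  assumes "0 < m" "0 < l" and q: "q \<in> int_vecs l" "q \<noteq> (\<lambda>_. 0)"
    and zero: "\<And>i. i < m \<Longrightarrow> err l A q p i = 0"
  shows "infinite (approx_set m l A v)"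
proof -
  define f where "f k = (\<lambda>j. int (Suc k) * q j)" for k
  have "f k \<in> approx_set m l A v" for k
  proof -
    have fk: "f k \<in> int_vecs l" "f k \<noteq> (\<lambda>_. 0)"
      using q by (auto simp: f_def int_vecs_def fun_eq_iff)
    have "err l A (f k) (\<lambda>i. int (Suc k) * p i) i = of_nat (Suc k) * err l A q p i" for i
      unfolding err_def f_def by (simp add: sum_distrib_left algebra_simps)
    then have "\<forall>i<m. \<bar>err l A (f k) (\<lambda>i. int (Suc k) * p i) i\<bar> < hgt l (f k) powr (- v)"
      using zero hgt_ge_1[OF fk] by auto
    then show ?thesis using fk assms by (auto simp: approx_set_def supnorm_less_iff)
  qed
  moreover have "inj f"
  proof (rule injI)
    fix a b assume ab: "f a = f b"
    obtain j where "q j \<noteq> 0" using q by auto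
    moreover have "int (Suc a) * q j = int (Suc b) * q j" using ab by (auto simp: f_def dest: fun_cong[of _ _ j])
    ultimately show "a = b" by simp
  qed
  ultimately show ?thesis
    using range_inj_infinite[of f] infinite_super[of "range f"] by blast
qed

lemma omega_mat_infinity_of_relation:
  assumes "0 < m" "0 < l" and q: "q \<in> int_vecs l" "q \<noteq> (\<lambda>_. 0)"
    and "\<And>i. i < m \<Longrightarrow> err l A q p i = 0"
  shows "omega_mat m l A = \<infinity>"
proof (rule ereal_top)
  fix B :: real
  have "ereal B \<le> ereal (max B 1)" by simp
  also have "\<dots> \<le> omega_mat m l A"
    by (intro omega_mat_geI infinite_approx_set_of_relation[OF assms]) auto
  finally show "ereal B \<le> omega_mat m l A" .
qed

section \<open>Error gaps, Dirichlet's theorem and the lower bound by the dimension\<close>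

lemma dist_int_pos:
  fixes t :: real
  assumes "\<And>p::int. t + of_int p \<noteq> 0"
  obtains c where "c > 0" "\<And>p::int. c \<le> \<bar>t + of_int p\<bar>"
proof
  have f: "frac t > 0" "frac t < 1"
    using assms[of "- \<lfloor>t\<rfloor>"] frac_lt_1[of t] of_int_floor_le[of t] by (auto simp: frac_def order.strict_iff_order)
  then show "min (frac t) (1 - frac t) > 0" by simp
  fix p :: int
  have t: "t = of_int \<lfloor>t\<rfloor> + frac t" by (simp add: frac_def)
  consider "\<lfloor>t\<rfloor> + p \<ge> 0" | "\<lfloor>t\<rfloor> + p \<le> -1" by linarith
  then show "min (frac t) (1 - frac t) \<le> \<bar>t + of_int p\<bar>"
  proof cases
    case 1
    then have "real_of_int (\<lfloor>t\<rfloor> + p) \<ge> 0" by linarith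
    then show ?thesis using t f by linarith
  next
    case 2
    then have "real_of_int (\<lfloor>t\<rfloor> + p) \<le> -1" by linarith
    then show ?thesis using t f by linarith
  qed
qed

text \<open>An exact relation for some member would put all its multiples into the set and make it
  infinite. Hence each member has a row whose value stays away from the integers, uniformly in
  \<open>p\<close>, and finitely many members leave a positive minimum.\<close>

lemma approx_set_error_gap:
  assumes m: "0 < m" and l: "0 < l" and fin: "finite (approx_set m l A v)"
  obtains d where "0 < d" "\<And>q p. q \<in> approx_set m l A v \<Longrightarrow> d \<le> supnorm m (err l A q p)"
proof -
  let ?S = "approx_set m l A v"
  have "\<exists>c>0. \<forall>p. c \<le> supnorm m (err l A q p)" if q: "q \<in> ?S" for q
  proof -
    let ?t = "\<lambda>i. \<Sum>j<l. A i j * of_int (q j)"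
    have "\<exists>i<m. \<forall>p::int. ?t i + of_int p \<noteq> 0"
    proof (rule ccontr)
      assume "\<not> ?thesis"
      then obtain P where "\<And>i. i < m \<Longrightarrow> ?t i + of_int (P i :: int) = 0" by metis
      then have "err l A q P i = 0" if "i < m" for i using that by (simp add: err_def)
      moreover have "q \<in> int_vecs l" using q by (simp add: approx_set_def)
      ultimately show False
        using infinite_approx_set_of_relation[of m l q A P v] approx_set_nonzero[OF m l q] m l fin
        by blast
    qed
    then obtain i where i: "i < m" "\<And>p::int. ?t i + of_int p \<noteq> 0" by blast
    obtain c where c: "c > 0" "\<And>p::int. c \<le> \<bar>?t i + of_int p\<bar>" using dist_int_pos[OF i(2)] by blast
    have "c \<le> supnorm m (err l A q p)" for p
      using c(2)[of "p i"] abs_le_supnorm[OF i(1), of "err l A q p"] by (simp add: err_def)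
    with c(1) show ?thesis by blast
  qed
  then obtain c where c: "\<And>q. q \<in> ?S \<Longrightarrow> c q > 0 \<and> (\<forall>p. c q \<le> supnorm m (err l A q p))" by metis
  define d where "d = Min (insert 1 (c ` ?S))"
  have d: "d > 0" "\<And>q. q \<in> ?S \<Longrightarrow> d \<le> c q"
    unfolding d_def using fin c by (auto simp: Min_gr_iff)
  show thesis
    by (rule that[OF d(1)]) (use d(2) c in \<open>blast intro: order_trans\<close>)
qed

text \<open>Pigeonhole: the \<open>(N + 1) ^ n\<close> integer points of a box fall into
  \<open>N ^ n\<close> cells of width \<open>1 / N ^ n\<close> for the fractional part of the form;
  the difference of two points in one cell is the required vector.\<close>

lemma Dirichlet_linear_form:
  assumes "0 < n" "0 < N"
  obtains q p where "q \<in> int_vecs n" "q \<noteq> (\<lambda>_. 0)" "hgt n q \<le> real N"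
    "\<bar>(\<Sum>j<n. y j * of_int (q j)) + of_int p\<bar> < 1 / real N ^ n"
proof -
  let ?Q = "PiE {..<n} (\<lambda>_. {0..int N})"
  define L where "L q = (\<Sum>j<n. y j * of_int (q j :: int))" for q
  define f where "f q = \<lfloor>real N ^ n * frac (L q)\<rfloor>" for q
  have N: "real N ^ n > 0" using assms by simp
  have "f ` ?Q \<subseteq> {0..<int N ^ n}"
  proof safe
    fix q
    have "0 \<le> real N ^ n * frac (L q)" using N by simp
    moreover have "real N ^ n * frac (L q) < real N ^ n * 1"
      using N frac_lt_1[of "L q"] by (intro mult_strict_left_mono) auto
    ultimately show "f q \<in> {0..<int N ^ n}"
      unfolding f_def by (simp add: floor_less_iff)
  qed
  then have "card (f ` ?Q) \<le> card {0..<int N ^ n}" by (intro card_mono) auto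
  also have "\<dots> = N ^ n" by (simp add: nat_power_eq)
  also have "\<dots> < (N + 1) ^ n" using assms by (intro power_strict_mono) auto
  also have "\<dots> = card ?Q" by (simp add: card_PiE nat_add_distrib)
  finally have "\<not> inj_on f ?Q" using card_image[of f ?Q] by auto
  then obtain q1 q2 where q: "q1 \<in> ?Q" "q2 \<in> ?Q" "q1 \<noteq> q2" "f q1 = f q2" by (auto simp: inj_on_def)
  let ?q = "\<lambda>j. if j < n then q1 j - q2 j else 0"
  show ?thesis
  proof (rule that)
    show "?q \<in> int_vecs n" by (simp add: int_vecs_def)
    obtain j where "j < n" "q1 j \<noteq> q2 j"
      using q(3) PiE_ext[OF q(1,2)] by auto
    then show "?q \<noteq> (\<lambda>_. 0)" by (auto simp: fun_eq_iff)
    have "\<bar>of_int (q1 j - q2 j)\<bar> \<le> real N" if "j < n" for j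
    proof -
      have "q1 j \<in> {0..int N}" "q2 j \<in> {0..int N}" using PiE_mem[OF q(1), of j] PiE_mem[OF q(2), of j] that by simp_all
      then show ?thesis by auto
    qed
    then show "hgt n ?q \<le> real N" using assms by (simp add: supnorm_le_iff)
    have "(\<Sum>j<n. y j * of_int (?q j)) = L q1 - L q2"
      unfolding L_def sum_subtractf[symmetric] by (intro sum.cong) (auto simp: algebra_simps)
    then have eq: "(\<Sum>j<n. y j * of_int (?q j)) + of_int (\<lfloor>L q2\<rfloor> - \<lfloor>L q1\<rfloor>) = frac (L q1) - frac (L q2)"
      by (simp add: frac_def)
    have "\<bar>real N ^ n * frac (L q1) - real N ^ n * frac (L q2)\<bar> < 1"
      using q(4) unfolding f_def by linarith
    then have "real N ^ n * \<bar>frac (L q1) - frac (L q2)\<bar> < 1"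
      using N by (simp add: abs_mult flip: right_diff_distrib)
    then show "\<bar>(\<Sum>j<n. y j * of_int (?q j)) + of_int (\<lfloor>L q2\<rfloor> - \<lfloor>L q1\<rfloor>)\<bar> < 1 / real N ^ n"
      unfolding eq using N by (simp add: field_simps)
  qed
qed

text \<open>If only finitely many vectors achieved exponent \<open>n\<close>, their errors would
  stay above some \<open>d > 0\<close>, while Dirichlet's theorem with \<open>N > 1 / d\<close>
  yields one with error below \<open>1 / N\<close>.\<close>

lemma omega_vec_ge_dim:
  assumes "0 < n"
  shows "ereal (real n) \<le> omega_vec n y"
proof -
  let ?S = "approx_set 1 n (\<lambda>i j. y j) (real n)"
  let ?L = "\<lambda>q p. (\<Sum>j<n. y j * of_int (q j)) + of_int (p::int)"
  have "infinite ?S"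
  proof
    assume fin: "finite ?S"
    obtain d where d: "0 < d" "\<And>q p. q \<in> ?S \<Longrightarrow> d \<le> supnorm 1 (err n (\<lambda>i j. y j) q p)"
      using approx_set_error_gap[OF _ assms fin] by auto
    obtain N where N: "1 / d < real N" using reals_Archimedean2 by blast
    have "N > 0" using N d(1) by (cases N) (auto simp: field_simps)
    obtain q p where q: "q \<in> int_vecs n" "q \<noteq> (\<lambda>_. 0)" "hgt n q \<le> real N" "\<bar>?L q p\<bar> < 1 / real N ^ n"
      using Dirichlet_linear_form[OF assms \<open>N > 0\<close>] by blast
    have h: "1 \<le> hgt n q" by (rule hgt_ge_1) fact+
    have "1 / real N ^ n \<le> 1 / hgt n q ^ n"
      using h q(3) by (intro divide_left_mono power_mono mult_pos_pos zero_less_power) auto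
    also have "\<dots> = hgt n q powr (- real n)"
      using h by (simp add: powr_minus powr_realpow divide_inverse)
    finally have "q \<in> ?S" using q
      by (auto simp: approx_set_def supnorm_1[unfolded One_nat_def] err_def intro!: exI[of _ "\<lambda>_. p"])
    then have "d \<le> \<bar>?L q p\<bar>"
      using d(2)[of q "\<lambda>_. p"] by (simp add: supnorm_1[unfolded One_nat_def] err_def)
    also note q(4)
    also have "1 / real N ^ n \<le> 1 / real N"
      using \<open>N > 0\<close> assms by (intro divide_left_mono self_le_power) auto
    also have "\<dots> < d" using N d(1) \<open>N > 0\<close> by (simp add: field_simps)
    finally have "d < d" .
    then show False by simp
  qed
  then show ?thesis
    unfolding omega_vec_def using assms by (intro omega_mat_geI) auto
qed

subsection \<open>Linear forms on the affine subspace\<close>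

lemma sum_lessThan_add_split:
  fixes f :: "nat \<Rightarrow> 'a::comm_monoid_add"
  shows "(\<Sum>j<a + b. f j) = (\<Sum>j<a. f j) + (\<Sum>j<b. f (a + j))"
  by (induction b) (simp_all add: add.assoc)

lemma ex_fun_at: "(\<exists>p. Q (p a)) \<longleftrightarrow> (\<exists>z. Q z)"
proof
  assume "\<exists>z. Q z"
  then obtain z where "Q z" ..
  then show "\<exists>p. Q (p a)" by (intro exI[of _ "\<lambda>_. z"])
qed blast

definition aff :: "nat \<Rightarrow> (nat \<Rightarrow> real) \<Rightarrow> (nat \<Rightarrow> real) \<Rightarrow> real" where
  "aff s w x = w 0 + (\<Sum>i<s. x i * w (Suc i))"

text \<open>The pairing of \<open>(x, x~ A)\<close> with an integer vector \<open>q\<close>, shifted by \<open>p\<close>, is the pairing of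
  \<open>x~\<close> with the vector \<open>A q\<^sub>2 + (p, q\<^sub>1)\<close>, where \<open>q = (q\<^sub>1, q\<^sub>2)\<close>.\<close>
definition resid :: "nat \<Rightarrow> nat \<Rightarrow> (nat \<Rightarrow> nat \<Rightarrow> real) \<Rightarrow> (nat \<Rightarrow> int) \<Rightarrow> int \<Rightarrow> nat \<Rightarrow> real" where
  "resid s n A q p = err (n - s) A (\<lambda>j. q (s + j)) (case_nat p q)"

lemma resid_0: "resid s n A q p 0 = resid s n A q 0 0 + of_int p"
  by (simp add: resid_def err_def)

lemma resid_Suc: "resid s n A q p (Suc i) = resid s n A q p' (Suc i)"
  by (simp add: resid_def err_def)

lemma Lmap_pairing:
  assumes "s < n"
  shows "(\<Sum>j<n. Lmap s n A x j * of_int (q j)) + of_int p = aff s (resid s n A q p) x"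
proof -
  let ?l = "n - s"
  have n: "{..<n} = {..<s + ?l}" using assms by simp
  have "(\<Sum>j<n. Lmap s n A x j * of_int (q j))
      = (\<Sum>j<s. Lmap s n A x j * of_int (q j)) + (\<Sum>j<?l. Lmap s n A x (s + j) * of_int (q (s + j)))"
    unfolding n sum_lessThan_add_split ..
  also have "(\<Sum>j<s. Lmap s n A x j * of_int (q j)) = (\<Sum>j<s. x j * of_int (q j))"
    using assms by (intro sum.cong) (auto simp: Lmap_def)
  also have "(\<Sum>j<?l. Lmap s n A x (s + j) * of_int (q (s + j)))
      = (\<Sum>j<?l. A 0 j * of_int (q (s + j)) + (\<Sum>i<s. x i * (A (Suc i) j * of_int (q (s + j)))))"
    by (intro sum.cong) (auto simp: Lmap_def distrib_right sum_distrib_right mult.assoc)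
  also have "\<dots> = (\<Sum>j<?l. A 0 j * of_int (q (s + j)))
      + (\<Sum>i<s. x i * (\<Sum>j<?l. A (Suc i) j * of_int (q (s + j))))"
    unfolding sum.distrib sum_distrib_left by (subst (2) sum.swap) simp
  finally show ?thesis
    unfolding aff_def resid_def err_def by (simp add: sum.distrib distrib_left)
qed

lemma approx_set_Lmap:
  assumes "s < n"
  shows "approx_set 1 n (\<lambda>i. Lmap s n A x) v
    = {q \<in> int_vecs n. \<exists>p. \<bar>aff s (resid s n A q p) x\<bar> < hgt n q powr (- v)}"
proof -
  have "err n (\<lambda>i. Lmap s n A x) q p 0 = aff s (resid s n A q (p 0)) x" for q p
    unfolding Lmap_pairing[OF assms, symmetric] err_def by simp
  moreover have "(\<exists>p. \<bar>aff s (resid s n A q (p (0::nat))) x\<bar> < c)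
      \<longleftrightarrow> (\<exists>p. \<bar>aff s (resid s n A q p) x\<bar> < c)" for q c
    by (rule ex_fun_at)
  ultimately show ?thesis unfolding approx_set_def supnorm_1 by simp
qed

lemma abs_aff_le: "\<bar>aff s w x\<bar> \<le> (1 + (\<Sum>i<s. \<bar>x i\<bar>)) * supnorm (s + 1) w"
proof -
  have "\<bar>aff s w x\<bar> \<le> \<bar>w 0\<bar> + (\<Sum>i<s. \<bar>x i\<bar> * \<bar>w (Suc i)\<bar>)"
    unfolding aff_def by (auto simp: abs_mult[symmetric] intro!: order_trans[OF abs_triangle_ineq] add_mono)
  also have "\<dots> \<le> supnorm (s + 1) w + (\<Sum>i<s. \<bar>x i\<bar> * supnorm (s + 1) w)"
    by (intro add_mono sum_mono mult_left_mono abs_le_supnorm) auto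
  finally show ?thesis by (simp add: distrib_right sum_distrib_right)
qed

text \<open>An approximation \<open>q\<close> for \<open>A\<close> with integer part
  \<open>P q\<close> lifts to \<open>F q\<close>, whose residual equals the error for
  \<open>A\<close> whatever \<open>x\<close> is. The lift costs bounded factors in height and value,
  depending on \<open>A\<close> and \<open>x\<close>, which the gap \<open>v < v'\<close> absorbs at
  large height.\<close>

lemma infinite_approx_set_Lmap:
  assumes sn: "s < n" and v: "0 \<le> v" "v < v'" and inf: "infinite (approx_set (s + 1) (n - s) A v')"
  shows "infinite (approx_set 1 n (\<lambda>i. Lmap s n A x) v)"
proof -
  define l where "l = n - s"
  have l: "0 < l" using sn by (simp add: l_def)
  let ?S = "approx_set (s + 1) l A v'"
  have "\<exists>p. supnorm (s + 1) (err l A q p) < hgt l q powr (- v')" if "q \<in> ?S" for q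
    using that by (auto simp: approx_set_def)
  then obtain P where P: "\<And>q. q \<in> ?S \<Longrightarrow> supnorm (s + 1) (err l A q (P q)) < hgt l q powr (- v')"
    by metis
  \<comment> \<open>Rows \<open>1\<close> to \<open>s\<close> of the integer part become the first
    \<open>s\<close> coordinates; row \<open>0\<close> serves as the integer shift.\<close>
  define F where "F q = (\<lambda>j. if j < s then P q (Suc j) else q (j - s))" for q
  \<comment> \<open>\<open>B\<close> bounds the value at \<open>x\<close> by the residual,
    \<open>K\<close> bounds the height of the lift, and \<open>H\<close> solves
    \<open>B * K powr v = H powr (v' - v)\<close>.\<close>
  define B where "B = 1 + (\<Sum>i<s. \<bar>x i\<bar>)"
  define K where "K = 1 + (\<Sum>i<s+1. \<Sum>j<l. \<bar>A i j\<bar>)"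
  define H where "H = (B * K powr v) powr (1 / (v' - v))"
  have B: "B \<ge> 1" and K: "K \<ge> 1" unfolding B_def K_def by (simp_all add: sum_nonneg del: sum.lessThan_Suc Suc_eq_plus1_left)
  have F: "F q \<in> approx_set 1 n (\<lambda>i. Lmap s n A x) v" if q: "q \<in> ?S" and qH: "H < hgt l q" for q
  proof -
    have ql: "q \<in> int_vecs l" using q by (simp add: approx_set_def)
    have Fn: "F q \<in> int_vecs n" using ql sn by (auto simp: int_vecs_def F_def l_def)
    have h: "1 \<le> hgt l q" using approx_set_nonzero[OF _ l q] ql by (intro hgt_ge_1) auto
    have res: "resid s n A (F q) (P q 0) i = err l A q (P q) i" if "i < s + 1" for i
      using that by (cases i) (auto simp: resid_def err_def F_def l_def)
    then have sn_eq: "supnorm (s + 1) (resid s n A (F q) (P q 0)) = supnorm (s + 1) (err l A q (P q))"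
      unfolding supnorm_def by (intro arg_cong[where f = Max] image_cong) auto
    have "hgt l q powr (- v') \<le> 1"
      using h v by (auto simp: powr_minus inverse_le_1_iff intro: ge_one_powr_ge_zero)
    have "\<bar>of_int (P q i)\<bar> \<le> K * hgt l q" if i: "i < s + 1" for i
    proof -
      have "\<bar>\<Sum>j<l. A i j * of_int (q j)\<bar> \<le> (\<Sum>j<l. \<bar>A i j\<bar> * hgt l q)"
        by (auto simp: abs_mult intro!: sum_norm_le[THEN order_trans] order_trans[OF sum_abs]
            sum_mono mult_left_mono abs_le_supnorm)
      also have "\<dots> \<le> (\<Sum>i<s+1. \<Sum>j<l. \<bar>A i j\<bar>) * hgt l q"
        unfolding sum_distrib_right[symmetric] using i h
        by (intro mult_right_mono member_le_sum sum_nonneg) auto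
      finally have "\<bar>\<Sum>j<l. A i j * of_int (q j)\<bar> \<le> (K - 1) * hgt l q" by (simp add: K_def)
      moreover have "\<bar>err l A q (P q) i\<bar> \<le> 1"
        using abs_le_supnorm[OF i, of "err l A q (P q)"] P[OF q] \<open>hgt l q powr (- v') \<le> 1\<close> by linarith
      ultimately have "\<bar>of_int (P q i)\<bar> \<le> (K - 1) * hgt l q + 1" unfolding err_def by linarith
      also have "\<dots> \<le> K * hgt l q" using h by (simp add: left_diff_distrib)
      finally show ?thesis .
    qed
    moreover have "\<bar>of_int (q j)\<bar> \<le> K * hgt l q" if "j < l" for j
    proof -
      have "\<bar>of_int (q j)\<bar> \<le> hgt l q" using that by (rule abs_le_supnorm)
      also have "\<dots> \<le> K * hgt l q" using K h by simp
      finally show ?thesis .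
    qed
    ultimately have hF: "hgt n (F q) \<le> K * hgt l q"
      using sn by (auto simp: supnorm_le_iff F_def l_def)
    have F0: "F q \<noteq> (\<lambda>_. 0)"
    proof
      assume "F q = (\<lambda>_. 0)"
      then have "q j = 0" for j by (auto simp: F_def fun_eq_iff dest: spec[of _ "j + s"])
      then show False using approx_set_nonzero[OF _ l q] by auto
    qed
    then have hF1: "1 \<le> hgt n (F q)" using Fn by (intro hgt_ge_1)
    have "B * K powr v = H powr (v' - v)" using v B K by (simp add: H_def powr_powr)
    also have "\<dots> \<le> hgt l q powr (v' - v)" using v qH by (intro powr_mono2) (auto simp: H_def)
    finally have "B * K powr v \<le> hgt l q powr (v' - v)" .
    then have "B * hgt l q powr (- v') \<le> (K * hgt l q) powr (- v)"
      using h K by (simp add: powr_minus powr_diff powr_mult field_simps)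
    also have "\<dots> \<le> hgt n (F q) powr (- v)"
      using hF hF1 v by (intro powr_mono2') auto
    finally have le: "B * hgt l q powr (- v') \<le> hgt n (F q) powr (- v)" .
    have "\<bar>aff s (resid s n A (F q) (P q 0)) x\<bar> \<le> B * supnorm (s + 1) (err l A q (P q))"
      using abs_aff_le[of s "resid s n A (F q) (P q 0)" x] unfolding sn_eq B_def .
    also have "\<dots> < B * hgt l q powr (- v')" using P[OF q] B by simp
    also note le
    finally show ?thesis unfolding approx_set_Lmap[OF sn] using Fn by blast
  qed
  \<comment> \<open>Discarding heights up to \<open>H\<close> removes finitely many vectors, and
    \<open>F\<close> is injective because the coordinates from \<open>s\<close> on return
    \<open>q\<close>.\<close>
  let ?T = "{q \<in> ?S. H < hgt l q}"
  have "?S \<subseteq> ?T \<union> {q \<in> int_vecs l. hgt l q \<le> H}" by (auto simp: approx_set_def)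
  then have "infinite ?T"
    using finite_int_vecs_bounded[OF l] inf finite_subset unfolding l_def by blast
  moreover have "inj F"
  proof (rule injI)
    fix a b assume ab: "F a = F b"
    show "a = b"
    proof
      fix j show "a j = b j" using fun_cong[OF ab, of "j + s"] by (simp add: F_def)
    qed
  qed
  ultimately have "infinite (F ` ?T)" using finite_imageD[OF _ inj_on_subset[OF _ subset_UNIV]] by blast
  moreover have "F ` ?T \<subseteq> approx_set 1 n (\<lambda>i. Lmap s n A x) v" using F by auto
  ultimately show ?thesis using finite_subset by blast
qed

lemma omega_vec_Lmap_gt:
  assumes "s < n" "0 \<le> v" "ereal v < omega_mat (s + 1) (n - s) A"
  shows "ereal v < omega_vec n (Lmap s n A x)"
proof -
  obtain v' where "v < v'" "infinite (approx_set (s + 1) (n - s) A v')"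
    using omega_mat_less_iff[of "s + 1" "n - s" v A] assms by auto
  \<comment> \<open>The lift loses some exponent, and the strict supremum bound needs an exponent
    above \<open>v\<close>, so \<open>u\<close> is placed between the two.\<close>
  moreover obtain u where "v < u" "u < v'" using \<open>v < v'\<close> dense by blast
  ultimately have "infinite (approx_set 1 n (\<lambda>i. Lmap s n A x) u)"
    using assms by (intro infinite_approx_set_Lmap[of s n u v']) auto
  with \<open>v < u\<close> show ?thesis
    unfolding omega_vec_def using assms omega_mat_less_iff[of 1 n v "\<lambda>i. Lmap s n A x"] by auto
qed

section \<open>Measurability and the lower bound for the measure\<close>

lemma countable_int_vecs: "countable (int_vecs n)"
proof (rule countable_subset)
  let ?f = "\<lambda>g j. if j < n then g j else (0::int)"
  show "countable (?f ` PiE {..<n} (\<lambda>_. UNIV))"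
    by (intro countable_image countable_PiE) auto
  show "int_vecs n \<subseteq> ?f ` PiE {..<n} (\<lambda>_. UNIV)"
  proof
    fix q assume "q \<in> int_vecs n"
    then have "q = ?f (restrict q {..<n})" by (auto simp: int_vecs_def fun_eq_iff not_less)
    then show "q \<in> ?f ` PiE {..<n} (\<lambda>_. UNIV)" by (intro image_eqI[where x = "restrict q {..<n}"]) auto
  qed
qed

text \<open>All quantifiers are made countable: the exponent may be taken rational because the
  approximation sets shrink as it grows, and an infinite set of integer vectors is one of unbounded
  height, since bounded height leaves finitely many.\<close>

lemma sets_euclid_omega_vec_gt:
  assumes "0 < n" "0 \<le> v"
  shows "{y \<in> space (euclid n). ereal v < omega_vec n y} \<in> sets (euclid n)"
proof -
  let ?S = "\<lambda>y u. approx_set 1 n (\<lambda>i. y) u"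
  have iff: "ereal v < omega_vec n y \<longleftrightarrow> (\<exists>r::rat. v < of_rat r \<and>
      (\<forall>N::nat. \<exists>q\<in>int_vecs n. real N \<le> hgt n q \<and> (\<exists>p::int.
        \<bar>(\<Sum>j<n. y j * of_int (q j)) + of_int p\<bar> < hgt n q powr (- of_rat r))))" for y
  proof -
    have "ereal v < omega_vec n y \<longleftrightarrow> (\<exists>u>v. infinite (?S y u))"
      unfolding omega_vec_def using assms by (intro omega_mat_less_iff) auto
    also have "\<dots> \<longleftrightarrow> (\<exists>r::rat. v < of_rat r \<and> infinite (?S y (of_rat r)))"
    proof safe
      fix u assume u: "v < u" "infinite (?S y u)"
      obtain r :: rat where r: "v < of_rat r" "of_rat r < u" using of_rat_dense[OF u(1)] by blast
      have "?S y u \<subseteq> ?S y (of_rat r)" using assms r by (intro approx_set_antimono) auto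
      then show "\<exists>r::rat. v < of_rat r \<and> infinite (?S y (of_rat r))"
        using u(2) r finite_subset by blast
    qed auto
    finally have gt_iff: "ereal v < omega_vec n y
      \<longleftrightarrow> (\<exists>r::rat. v < of_rat r \<and> infinite (?S y (of_rat r)))" .
    have inf_iff: "infinite (?S y u) \<longleftrightarrow> (\<forall>N::nat. \<exists>q\<in>?S y u. real N \<le> hgt n q)" for u
    proof safe
      fix N :: nat assume inf: "infinite (?S y u)"
      show "\<exists>q\<in>?S y u. real N \<le> hgt n q"
      proof (rule ccontr)
        assume "\<not> ?thesis"
        then have "?S y u \<subseteq> {q \<in> int_vecs n. hgt n q \<le> real N}"
          by (force simp: approx_set_def)
        then show False using inf finite_int_vecs_bounded[OF assms(1)] finite_subset by blast
      qed
    next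
      assume N: "\<forall>N::nat. \<exists>q\<in>?S y u. real N \<le> hgt n q" and fin: "finite (?S y u)"
      obtain N where "Max (hgt n ` ?S y u) < real N" using reals_Archimedean2 by blast
      moreover obtain q where "q \<in> ?S y u" "real N \<le> hgt n q" using N by blast
      moreover have "hgt n q \<le> Max (hgt n ` ?S y u)"
        using \<open>q \<in> ?S y u\<close> fin by (intro Max_ge) auto
      ultimately show False by linarith
    qed
    have "(\<exists>q\<in>?S y u. real N \<le> hgt n q) \<longleftrightarrow> (\<exists>q\<in>int_vecs n. real N \<le> hgt n q \<and> (\<exists>p::int.
        \<bar>(\<Sum>j<n. y j * of_int (q j)) + of_int p\<bar> < hgt n q powr (- u)))" for N :: nat and u
    proof -
      have "(\<exists>p. \<bar>err n (\<lambda>i. y) q p 0\<bar> < c) \<longleftrightarrow> (\<exists>p::int. \<bar>(\<Sum>j<n. y j * of_int (q j)) + of_int p\<bar> < c)"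
        for q c unfolding err_def by (rule ex_fun_at)
      then show ?thesis unfolding approx_set_def supnorm_1 by auto
    qed
    then show ?thesis unfolding gt_iff inf_iff by simp
  qed
  have [measurable]: "(\<lambda>y. y j) \<in> borel_measurable (euclid n)" if "j < n" for j
    using that unfolding euclid_def by (auto intro!: measurable_component_singleton)
  have [measurable]: "(\<lambda>y. \<Sum>j<n. y j * of_int (q j)) \<in> borel_measurable (euclid n)" for q :: "nat \<Rightarrow> int"
    by (intro borel_measurable_sum borel_measurable_times) auto
  have "Measurable.pred (euclid n) (\<lambda>y. \<exists>q\<in>int_vecs n. real N \<le> hgt n q \<and> (\<exists>p::int.
      \<bar>(\<Sum>j<n. y j * of_int (q j)) + of_int p\<bar> < hgt n q powr (- of_rat r)))" for N r
  proof -
    let ?R = "\<lambda>q. {y \<in> space (euclid n). real N \<le> hgt n q \<and> (\<exists>p::int.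
      \<bar>(\<Sum>j<n. y j * of_int (q j)) + of_int p\<bar> < hgt n q powr (- of_rat r))}"
    have "(\<Union>q\<in>int_vecs n. ?R q) \<in> sets (euclid n)"
      by (rule sets.countable_UN''[OF countable_int_vecs]) measurable
    moreover have "(\<Union>q\<in>int_vecs n. ?R q) = {y \<in> space (euclid n). \<exists>q\<in>int_vecs n. real N \<le> hgt n q \<and> (\<exists>p::int.
      \<bar>(\<Sum>j<n. y j * of_int (q j)) + of_int p\<bar> < hgt n q powr (- of_rat r))}" by blast
    ultimately show ?thesis by (simp add: pred_def)
  qed
  then show ?thesis unfolding iff by measurable
qed

lemma measurable_Lmap: "Lmap s n A \<in> measurable (euclid s) (euclid n)"
  unfolding euclid_def
proof (rule measurable_PiM_single')
  fix j assume j: "j \<in> {..<n}"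
  have c: "(\<lambda>y. y i) \<in> borel_measurable (PiM {..<s} (\<lambda>_. lborel))" if "i < s" for i
    using that by (auto intro!: measurable_component_singleton)
  show "(\<lambda>x. Lmap s n A x j) \<in> measurable (PiM {..<s} (\<lambda>_. lborel)) lborel"
    using j by (cases "j < s")
      (auto simp: Lmap_def c intro!: borel_measurable_add borel_measurable_sum borel_measurable_times)
next
  show "Lmap s n A \<in> space (PiM {..<s} (\<lambda>_. lborel)) \<rightarrow> PiE {..<n} (\<lambda>_. space lborel)"
    by (auto simp: Lmap_def)
qed

lemma emeasure_space_euclid_pos: "0 < emeasure (euclid k) (space (euclid k))"
proof -
  interpret product_sigma_finite "\<lambda>_::nat. lborel :: real measure" by standard
  have "emeasure (euclid k) (PiE {..<k} (\<lambda>_. {0..1})) = 1"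
    unfolding euclid_def by (subst emeasure_PiM) auto
  moreover have "emeasure (euclid k) (PiE {..<k} (\<lambda>_. {0..1})) \<le> emeasure (euclid k) (space (euclid k))"
    by (rule emeasure_space)
  ultimately show ?thesis by (metis zero_less_one order_less_le_trans)
qed

text \<open>The preimage of the level set is the whole parameter space. Measurability matters here,
  since \<open>emeasure\<close> is 0 on nonmeasurable sets.\<close>

lemma omega_measure_L_measure_ge:
  assumes "s < n" "0 \<le> v" "\<And>x. ereal v < omega_vec n (Lmap s n A x)"
  shows "ereal v \<le> omega_measure n (L_measure s n A)"
proof -
  let ?E = "{y \<in> space (L_measure s n A). ereal v < omega_vec n y}"
  have "?E = {y \<in> space (euclid n). ereal v < omega_vec n y}" by (simp add: L_measure_def)
  also have "\<dots> \<in> sets (euclid n)" using assms by (intro sets_euclid_omega_vec_gt) auto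
  finally have "?E \<in> sets (euclid n)" .
  then have "emeasure (L_measure s n A) ?E
      = emeasure (euclid s) (Lmap s n A -` ?E \<inter> space (euclid s))"
    unfolding L_measure_def by (intro emeasure_distr measurable_Lmap)
  also have "Lmap s n A -` ?E \<inter> space (euclid s) = space (euclid s)"
    using measurable_space[OF measurable_Lmap, of _ s n A] assms(3) by (auto simp: L_measure_def)
  finally show ?thesis
    unfolding omega_measure_def using emeasure_space_euclid_pos[of s]
    by (intro Sup_upper) auto
qed

lemma omega_L_measure_lower:
  assumes "s < n"
  shows "max (omega_mat (s + 1) (n - s) A) (ereal (real n)) \<le> omega_measure n (L_measure s n A)"
proof (rule dense_le)
  fix z assume z: "z < max (omega_mat (s + 1) (n - s) A) (ereal (real n))"
  show "z \<le> omega_measure n (L_measure s n A)"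
  proof -
    have key: "ereal v \<le> omega_measure n (L_measure s n A)"
      if "0 \<le> v" "ereal v < max (omega_mat (s + 1) (n - s) A) (ereal (real n))" for v
    proof (rule omega_measure_L_measure_ge)
      fix x
      consider "ereal v < omega_mat (s + 1) (n - s) A" | "ereal v < ereal (real n)"
        using \<open>ereal v < max _ _\<close> by (auto simp: less_max_iff_disj)
      then show "ereal v < omega_vec n (Lmap s n A x)"
      proof cases
        case 1 then show ?thesis using omega_vec_Lmap_gt assms that by blast
      next
        case 2 then show ?thesis
          using omega_vec_ge_dim[of n "Lmap s n A x"] assms by (intro less_le_trans[OF 2]) auto
      qed
    qed (use assms that in auto)
    have "0 < ereal (real n)" using assms by simp
    then have "0 < max (omega_mat (s + 1) (n - s) A) (ereal (real n))"
      by (rule less_le_trans) (rule max.cobounded2)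
    \<comment> \<open>Passing to \<open>max z 0\<close> covers negative \<open>z\<close>, as the
      bounds on exponents are stated for \<open>0 \<le> v\<close>.\<close>
    with z have "max z 0 < max (omega_mat (s + 1) (n - s) A) (ereal (real n))"
      by (rule max_less_iff_conj[THEN iffD2, OF conjI])
    moreover from this obtain v where "max z 0 = ereal v"
      by (cases "max z 0") auto
    moreover from this have "0 \<le> v" by (metis ereal_less_eq(5) max.cobounded2)
    ultimately have "max z 0 \<le> omega_measure n (L_measure s n A)" using key by simp
    then show ?thesis by simp
  qed
qed

subsection \<open>Slabs and the Borel-Cantelli lemma\<close>

text \<open>First Borel-Cantelli lemma: the function counting the \<open>i\<close> with
  \<open>x \<in> E i\<close> has integral at most the sum of the \<open>f i\<close>, so it is finite
  almost everywhere.\<close>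

lemma AE_finite_of_summable:
  fixes f :: "'i \<Rightarrow> real"
  assumes I: "countable I" and E: "\<And>i. i \<in> I \<Longrightarrow> E i \<in> sets M"
    and le: "\<And>i. i \<in> I \<Longrightarrow> emeasure M (E i) \<le> ennreal (f i)"
    and f0: "\<And>i. i \<in> I \<Longrightarrow> 0 \<le> f i" and f: "f summable_on I"
  shows "AE x in M. finite {i \<in> I. x \<in> E i}"
proof -
  have fin: "(\<integral>\<^sup>+i. ennreal (f i) \<partial>count_space I) < \<infinity>"
  proof -
    have "(\<lambda>i. norm (f i)) summable_on I" using f f0 by (simp cong: summable_on_cong)
    then have "integrable (count_space I) f"
      using abs_summable_equivalent[of f I] by (simp add: Infinite_Set_Sum.abs_summable_on_def)
    then have "(\<integral>\<^sup>+i. ennreal (norm (f i)) \<partial>count_space I) < \<infinity>"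
      by (simp add: integrable_iff_bounded)
    also have "(\<integral>\<^sup>+i. ennreal (norm (f i)) \<partial>count_space I) = (\<integral>\<^sup>+i. ennreal (f i) \<partial>count_space I)"
      using f0 by (intro nn_integral_cong) auto
    finally show ?thesis .
  qed
  have meas: "(\<lambda>x. \<integral>\<^sup>+i. indicator (E i) x \<partial>count_space I) \<in> borel_measurable M"
  proof (cases "finite I")
    case True
    then show ?thesis using E by (simp add: nn_integral_count_space_finite)
  next
    case False
    note bij = bij_betw_from_nat_into[OF I False]
    have "(\<integral>\<^sup>+i. indicator (E i) x \<partial>count_space I) = (\<Sum>n. indicator (E (from_nat_into I n)) x)" for x
      by (simp add: nn_integral_bij_count_space[symmetric, OF bij] nn_integral_count_space_nat)
    moreover have "E (from_nat_into I n) \<in> sets M" for n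
      using E from_nat_into[of I n] False by auto
    ultimately show ?thesis by simp
  qed
  have "(\<integral>\<^sup>+x. \<integral>\<^sup>+i. indicator (E i) x \<partial>count_space I \<partial>M)
      = (\<integral>\<^sup>+i. \<integral>\<^sup>+x. indicator (E i) x \<partial>M \<partial>count_space I)"
    using E by (intro nn_integral_count_space_nn_integral[OF I]) auto
  also have "\<dots> \<le> (\<integral>\<^sup>+i. ennreal (f i) \<partial>count_space I)"
    using E le by (intro nn_integral_mono) simp
  finally have "(\<integral>\<^sup>+x. \<integral>\<^sup>+i. indicator (E i) x \<partial>count_space I \<partial>M) \<noteq> \<infinity>"
    using fin by (auto simp: top_unique)
  then have "AE x in M. (\<integral>\<^sup>+i. indicator (E i) x \<partial>count_space I) \<noteq> \<infinity>"
    using meas by (intro nn_integral_PInf_AE) auto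
  then show ?thesis
  proof (rule AE_mp, intro AE_I2 impI)
    fix x assume *: "(\<integral>\<^sup>+i. indicator (E i) x \<partial>count_space I) \<noteq> \<infinity>"
    have "(\<integral>\<^sup>+i. indicator (E i) x \<partial>count_space I)
        = (\<integral>\<^sup>+i. indicator {i \<in> I. x \<in> E i} i \<partial>count_space I)"
      by (intro nn_integral_cong) (auto simp: indicator_def)
    also have "\<dots> = emeasure (count_space I) {i \<in> I. x \<in> E i}"
      by (intro nn_integral_indicator) auto
    finally show "finite {i \<in> I. x \<in> E i}"
      using * by (auto simp: emeasure_count_space split: if_splits)
  qed
qed

lemma summable_on_int_powr:
  assumes "1 < a"
  shows "(\<lambda>k::int. (1 + \<bar>of_int k\<bar>) powr (- a) :: real) summable_on UNIV"
proof -
  let ?f = "\<lambda>k::int. (1 + \<bar>of_int k\<bar>) powr (- a) :: real"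
  have "summable (\<lambda>n. real n powr (- a))" using assms by (simp add: summable_real_powr_iff)
  then have "summable (\<lambda>n. real (Suc n) powr (- a))" by (subst summable_Suc_iff)
  then have nat: "(\<lambda>n. real (Suc n) powr (- a)) summable_on UNIV"
    by (intro norm_summable_imp_summable_on) simp
  have "(?f \<circ> int) summable_on UNIV" "(?f \<circ> (\<lambda>n. - int n)) summable_on UNIV"
    using nat by (auto simp: o_def add.commute)
  then have "?f summable_on range int" "?f summable_on range (\<lambda>n. - int n)"
    by (auto simp: summable_on_reindex inj_on_def)
  then have "?f summable_on (range int \<union> range (\<lambda>n. - int n))"
    by (rule summable_on_union)
  moreover have "range int \<union> range (\<lambda>n. - int n) = UNIV"
    by (metis (no_types, lifting) UNIV_eq_I UnCI int_cases2 rangeI)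
  ultimately show ?thesis by simp
qed

text \<open>Comparison with the product \<open>\<Prod>j<n. (1 + \<bar>q j\<bar>) powr (- v / n)\<close>, which sums one coordinate at a time.\<close>
lemma summable_on_hgt_powr:
  assumes n: "0 < n" and v: "real n < v"
  shows "(\<lambda>q. hgt n q powr (- v)) summable_on (int_vecs n - {\<lambda>_. 0})"
proof -
  define a where "a = v / real n"
  have a: "1 < a" using assms by (simp add: a_def field_simps)
  let ?f = "\<lambda>k::int. (1 + \<bar>of_int k\<bar>) powr (- a) :: real"
  let ?g = "\<lambda>q. \<Prod>j<n. ?f (q j)"
  have "Infinite_Set_Sum.abs_summable_on ?f UNIV"
    using summable_on_int_powr[OF a] by (simp add: abs_summable_equivalent[symmetric])
  then have "Infinite_Set_Sum.abs_summable_on ?g (PiE {..<n} (\<lambda>_. UNIV))"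
    by (intro abs_summable_on_prod_PiE) auto
  then have "?g summable_on PiE {..<n} (\<lambda>_. UNIV)"
    using abs_summable_equivalent abs_summable_summable by blast
  moreover have "bij_betw (\<lambda>q. restrict q {..<n}) (int_vecs n) (PiE {..<n} (\<lambda>_. UNIV))"
    by (rule bij_betw_byWitness[where f' = "\<lambda>g j. if j < n then g j else 0"])
      (auto simp: int_vecs_def fun_eq_iff not_less PiE_def extensional_def)
  ultimately have "(\<lambda>q. ?g (restrict q {..<n})) summable_on int_vecs n"
    using summable_on_reindex_bij_betw[of "\<lambda>q. restrict q {..<n}" "int_vecs n" _ ?g] by blast
  then have "(\<lambda>q. 2 powr v * ?g q) summable_on int_vecs n"
    by (intro summable_on_cmult_right) (auto elim!: back_subst[of "\<lambda>f. f summable_on _"] intro!: prod.cong)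
  then have "(\<lambda>q. 2 powr v * ?g q) summable_on (int_vecs n - {\<lambda>_. 0})"
    by (rule summable_on_subset_banach) auto
  then show ?thesis
  proof (rule summable_on_comparison_test)
    fix q assume q: "q \<in> int_vecs n - {\<lambda>_. 0}"
    then have h: "1 \<le> hgt n q" by (intro hgt_ge_1) auto
    \<comment> \<open>Here \<open>1 + |q j| \<le> 2 * hgt n q\<close>, because the height of a
      nonzero integer vector is at least 1.\<close>
    have "(2 * hgt n q) powr (- a) \<le> ?f (q j)" if "j < n" for j
      using abs_le_supnorm[OF that, of "\<lambda>j. of_int (q j)"] h a by (intro powr_mono2') auto
    then have "(\<Prod>j<n. (2 * hgt n q) powr (- a)) \<le> ?g q"
      by (intro prod_mono) auto
    moreover have "(\<Prod>j<n. (2 * hgt n q) powr (- a)) = (2 * hgt n q) powr (- v)"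
      using h n by (simp add: powr_realpow[symmetric] powr_powr a_def)
    moreover have "(2 * hgt n q) powr (- v) = 2 powr (- v) * hgt n q powr (- v)"
      using h by (simp add: powr_mult)
    ultimately have "2 powr v * (2 powr (- v) * hgt n q powr (- v)) \<le> 2 powr v * ?g q"
      by (intro mult_left_mono) simp_all
    moreover have "2 powr v * (2 powr (- v) * z) = z" for z :: real by (simp add: powr_minus)
    ultimately show "hgt n q powr (- v) \<le> 2 powr v * ?g q" by simp
  qed auto
qed

section \<open>Measure of slabs in a box\<close>

definition cbox_fun :: "nat \<Rightarrow> real \<Rightarrow> (nat \<Rightarrow> real) set" where
  "cbox_fun s R = PiE {..<s} (\<lambda>_. {-R..R})"

lemma mem_cbox_fun_iff: "x \<in> cbox_fun s R \<longleftrightarrow> x \<in> extensional {..<s} \<and> (\<forall>i<s. \<bar>x i\<bar> \<le> R)"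
proof -
  have "x i \<in> {-R..R} \<longleftrightarrow> \<bar>x i\<bar> \<le> R" for i by auto
  then show ?thesis unfolding cbox_fun_def PiE_iff by auto
qed

definition slab :: "nat \<Rightarrow> real \<Rightarrow> (nat \<Rightarrow> real) \<Rightarrow> real \<Rightarrow> (nat \<Rightarrow> real) set" where
  "slab s R w d = {x \<in> cbox_fun s R. \<bar>aff s w x\<bar> < d}"

lemma cbox_fun_subset_space: "cbox_fun s R \<subseteq> space (euclid s)"
  by (auto simp: cbox_fun_def euclid_def space_PiM)

lemma sets_cbox_fun [measurable]: "cbox_fun s R \<in> sets (euclid s)"
  unfolding cbox_fun_def euclid_def by (intro sets_PiM_I_finite) auto

lemma measurable_aff [measurable]: "aff s w \<in> borel_measurable (euclid s)"
  unfolding aff_def[abs_def] euclid_def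
  by (intro borel_measurable_add borel_measurable_sum borel_measurable_times)
    (auto intro!: measurable_component_singleton)

lemma sets_slab [measurable]: "slab s R w d \<in> sets (euclid s)"
proof -
  have "slab s R w d = cbox_fun s R \<inter> {x \<in> space (euclid s). \<bar>aff s w x\<bar> < d}"
    using cbox_fun_subset_space by (auto simp: slab_def)
  then show ?thesis by simp
qed

lemma emeasure_cbox_fun:
  assumes "0 \<le> R"
  shows "emeasure (euclid s) (cbox_fun s R) = ennreal ((2 * R) ^ s)"
proof -
  interpret product_sigma_finite "\<lambda>_::nat. lborel :: real measure" by standard
  show ?thesis
    unfolding euclid_def cbox_fun_def using assms
    by (subst emeasure_PiM) (auto simp: ennreal_power)
qed

text \<open>Fubini in coordinate \<open>i\<close>: with the others fixed, the form is affine in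
  \<open>x i\<close> with slope \<open>w (Suc i)\<close>, so the slice lies in an interval of length
  \<open>2 * d / |w (Suc i)|\<close>; the others contribute the volume of their box.\<close>

lemma emeasure_slab_coordinate:
  assumes R: "0 \<le> R" and i: "i < s" and w: "w (Suc i) \<noteq> 0" and d: "0 < d"
  shows "emeasure (euclid s) (slab s R w d) \<le> ennreal ((2 * R) ^ (s - 1) * (2 * d / \<bar>w (Suc i)\<bar>))"
proof -
  interpret product_sigma_finite "\<lambda>_::nat. lborel :: real measure" by standard
  let ?I = "{..<s} - {i}"
  have ins: "insert i ?I = {..<s}" using i by auto
  have meas: "(indicator (slab s R w d) :: _ \<Rightarrow> ennreal) \<in> borel_measurable (PiM (insert i ?I) (\<lambda>_. lborel))"
    using sets_slab[of s R w d] unfolding ins euclid_def by simp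
  have "emeasure (euclid s) (slab s R w d) = (\<integral>\<^sup>+x. indicator (slab s R w d) x \<partial>(PiM (insert i ?I) (\<lambda>_. lborel)))"
    unfolding ins using sets_slab[of s R w d] by (simp add: euclid_def)
  also have "\<dots> = (\<integral>\<^sup>+x. (\<integral>\<^sup>+t. indicator (slab s R w d) (x(i := t)) \<partial>lborel) \<partial>(PiM ?I (\<lambda>_. lborel)))"
    by (rule product_nn_integral_insert[OF _ _ meas]) auto
  also have "\<dots> \<le> (\<integral>\<^sup>+x. ennreal (2 * d / \<bar>w (Suc i)\<bar>) * indicator (PiE ?I (\<lambda>_. {-R..R})) x \<partial>(PiM ?I (\<lambda>_. lborel)))"
  proof (intro nn_integral_mono)
    fix x assume x: "x \<in> space (PiM ?I (\<lambda>_. lborel :: real measure))"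
    define c where "c = w 0 + (\<Sum>k\<in>?I. x k * w (Suc k))"
    define \<omega> where "\<omega> = w (Suc i)"
    have aff: "aff s w (x(i := t)) = c + t * \<omega>" for t
    proof -
      have "(\<Sum>k<s. (x(i := t)) k * w (Suc k)) = t * w (Suc i) + (\<Sum>k\<in>?I. (x(i := t)) k * w (Suc k))"
        using i by (subst sum.remove[of _ i]) auto
      also have "(\<Sum>k\<in>?I. (x(i := t)) k * w (Suc k)) = (\<Sum>k\<in>?I. x k * w (Suc k))"
        by (intro sum.cong) auto
      finally show ?thesis by (simp add: aff_def c_def \<omega>_def)
    qed
    show "(\<integral>\<^sup>+t. indicator (slab s R w d) (x(i := t)) \<partial>lborel)
      \<le> ennreal (2 * d / \<bar>w (Suc i)\<bar>) * indicator (PiE ?I (\<lambda>_. {-R..R})) x"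
    proof (cases "x \<in> PiE ?I (\<lambda>_. {-R..R})")
      case False
      have "x(i := t) \<notin> slab s R w d" for t
      proof
        assume "x(i := t) \<in> slab s R w d"
        then have b: "\<And>k. k < s \<Longrightarrow> (x(i := t)) k \<in> {-R..R}" unfolding slab_def cbox_fun_def by (blast dest: PiE_mem)
        have "x k \<in> {-R..R}" if "k \<in> ?I" for k using b[of k] that by auto
        moreover have "x \<in> extensional ?I" using x by (simp add: space_PiM PiE_def)
        ultimately show False using False by (auto simp: PiE_def)
      qed
      then show ?thesis by simp
    next
      case True
      have "(indicator (slab s R w d) (x(i := t)) :: ennreal) \<le> indicator {- c / \<omega> - d / \<bar>\<omega>\<bar>..- c / \<omega> + d / \<bar>\<omega>\<bar>} t" for t
      proof (cases "x(i := t) \<in> slab s R w d")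
        case True
        then have "\<bar>c + t * \<omega>\<bar> < d" by (simp add: slab_def aff)
        moreover have "c + t * \<omega> = (t - (- c / \<omega>)) * \<omega>" using w by (simp add: \<omega>_def field_simps)
        ultimately have "\<bar>t - (- c / \<omega>)\<bar> * \<bar>\<omega>\<bar> < d" by (simp add: abs_mult)
        then have "\<bar>t - (- c / \<omega>)\<bar> < d / \<bar>\<omega>\<bar>" using w by (simp add: \<omega>_def pos_less_divide_eq)
        then have "t \<in> {- c / \<omega> - d / \<bar>\<omega>\<bar>..- c / \<omega> + d / \<bar>\<omega>\<bar>}" unfolding atLeastAtMost_iff by linarith
        then show ?thesis using True by simp
      qed simp
      then have "(\<integral>\<^sup>+t. indicator (slab s R w d) (x(i := t)) \<partial>lborel)
          \<le> (\<integral>\<^sup>+t. indicator {- c / \<omega> - d / \<bar>\<omega>\<bar>..- c / \<omega> + d / \<bar>\<omega>\<bar>} t \<partial>lborel)"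
        by (intro nn_integral_mono)
      also have "\<dots> = ennreal (2 * d / \<bar>\<omega>\<bar>)" using d by simp
      finally show ?thesis using True by (simp add: \<omega>_def)
    qed
  qed
  also have "\<dots> = ennreal (2 * d / \<bar>w (Suc i)\<bar>) * emeasure (PiM ?I (\<lambda>_. lborel)) (PiE ?I (\<lambda>_. {-R..R}))"
    by (subst nn_integral_cmult_indicator) (auto intro!: sets_PiM_I_finite)
  also have "emeasure (PiM ?I (\<lambda>_. lborel)) (PiE ?I (\<lambda>_. {-R..R})) = ennreal ((2 * R) ^ (s - 1))"
    using R i by (subst emeasure_PiM) (auto simp: ennreal_power)
  also have "ennreal (2 * d / \<bar>w (Suc i)\<bar>) * ennreal ((2 * R) ^ (s - 1))
      = ennreal ((2 * R) ^ (s - 1) * (2 * d / \<bar>w (Suc i)\<bar>))"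
    using R d by (subst ennreal_mult[symmetric]) (auto simp: mult.commute)
  finally show ?thesis .
qed

text \<open>The coordinate estimate needs a linear coefficient comparable to the norm of
  \<open>w\<close>. If the norm is attained at the constant term, then either \<open>d\<close> is so
  large that the volume of the box suffices, or a nonempty slab forces the linear part to be large
  as well.\<close>

lemma slab_bound:
  assumes R: "1 \<le> R" and w: "0 < supnorm (s + 1) w" and d: "0 < d"
  shows "emeasure (euclid s) (slab s R w d) \<le> ennreal ((2 * R) ^ s * (2 + 2 * real s) * d / supnorm (s + 1) w)"
proof -
  define t where "t = supnorm (s + 1) w"
  define C where "C = (2 * R) ^ s * (2 + 2 * real s)"
  have t: "0 < t" using w by (simp add: t_def)
  \<comment> \<open>The factor 1 serves a norm attained at \<open>w (Suc i)\<close> itself, the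
    factor \<open>2 * real s * R\<close> the case where the linear part has to balance
    \<open>w 0\<close>.\<close>
  have coord: ?thesis if i: "i < s" and le: "t \<le> max 1 (2 * real s * R) * \<bar>w (Suc i)\<bar>" for i
  proof -
    have w0: "w (Suc i) \<noteq> 0" using le t by auto
    have s: "s = Suc (s - 1)" using i by simp
    have "max 1 (2 * real s * R) = 2 * real s * R"
    proof -
      have "1 \<le> real s" using i by simp
      then have "1 * 1 \<le> real s * R" using R by (intro mult_mono) auto
      then show ?thesis by simp
    qed
    then have le': "t \<le> 2 * real s * R * \<bar>w (Suc i)\<bar>" using le by simp
    have "2 * d / \<bar>w (Suc i)\<bar> \<le> 2 * d * (2 * real s * R) / t"
      using le' t w0 d by (simp add: field_simps)
    then have "(2 * R) ^ (s - 1) * (2 * d / \<bar>w (Suc i)\<bar>) \<le> (2 * R) ^ (s - 1) * (2 * d * (2 * real s * R) / t)"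
      using R by (intro mult_left_mono) auto
    also have "\<dots> = (2 * R) ^ s * (2 * real s) * d / t"
      by (subst (2) s) (simp add: field_simps)
    also have "\<dots> \<le> C * d / t"
      unfolding C_def using R d t by (intro divide_right_mono mult_right_mono mult_left_mono) auto
    finally show ?thesis
      using emeasure_slab_coordinate[of R i s w d] i w0 d R unfolding C_def t_def
      by (auto intro: order_trans ennreal_leI)
  qed
  obtain k where k: "k < s + 1" "t = \<bar>w k\<bar>" using supnorm_attained[of "s + 1" w] by (auto simp: t_def)
  show ?thesis
  proof (cases k)
    case (Suc i)
    then show ?thesis using k by (intro coord[of i]) (auto simp: max_def mult_le_cancel_right1)
  next
    case 0
    consider "slab s R w d = {}" | "t < 2 * d" | x where "x \<in> slab s R w d" "2 * d \<le> t" by force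
    then show ?thesis
    proof cases
      case 1 then show ?thesis by simp
    next
      case 2
      have "emeasure (euclid s) (slab s R w d) \<le> emeasure (euclid s) (cbox_fun s R)"
        by (intro emeasure_mono sets_cbox_fun) (auto simp: slab_def)
      also have "\<dots> = ennreal ((2 * R) ^ s)" using R by (intro emeasure_cbox_fun) auto
      also have "\<dots> \<le> ennreal (C * d / t)"
      proof (rule ennreal_leI)
        have "(2 * R) ^ s * t \<le> (2 * R) ^ s * ((2 + 2 * real s) * d)"
          using 2 R d by (intro mult_left_mono) (auto simp: distrib_right intro: add_increasing2)
        then show "(2 * R) ^ s \<le> C * d / t" using t by (simp add: C_def field_simps)
      qed
      finally show ?thesis by (simp add: C_def t_def)
    next
      case 3
      have x: "\<bar>x i\<bar> \<le> R" if "i < s" for i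
        using 3 that by (simp add: slab_def mem_cbox_fun_iff)
      have "\<bar>w 0 + (\<Sum>i<s. x i * w (Suc i))\<bar> < d" using 3 by (simp add: slab_def aff_def)
      \<comment> \<open>Since \<open>|w 0| = t\<close> and \<open>2 * d \<le> t\<close>, the linear
        part exceeds \<open>t - d \<ge> t / 2\<close>; one of its \<open>s\<close> terms must then
        have a large coefficient.\<close>
      then have gt: "t / 2 < \<bar>\<Sum>i<s. x i * w (Suc i)\<bar>" using 3 k(2)[unfolded 0] by linarith
      have "\<exists>i<s. t \<le> 2 * real s * R * \<bar>w (Suc i)\<bar>"
      proof (rule ccontr)
        assume neg: "\<not> ?thesis"
        have "s \<noteq> 0" using gt t by (intro notI) simp
        then have sR: "0 < 2 * real s * R" using R by simp
        have "\<bar>\<Sum>i<s. x i * w (Suc i)\<bar> \<le> (\<Sum>i<s. \<bar>x i\<bar> * \<bar>w (Suc i)\<bar>)"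
          by (rule order_trans[OF sum_abs]) (simp add: abs_mult)
        also have "\<dots> \<le> (\<Sum>i<s. R * (t / (2 * real s * R)))"
        proof (intro sum_mono mult_mono)
          fix i assume "i \<in> {..<s}"
          then show "\<bar>w (Suc i)\<bar> \<le> t / (2 * real s * R)"
            using neg sR by (auto simp: pos_le_divide_eq mult.commute not_le)
        qed (use x R in auto)
        also have "\<dots> = t / 2" using \<open>s \<noteq> 0\<close> R by (simp add: field_simps)
        finally show False using gt by simp
      qed
      then obtain i where "i < s" "t \<le> 2 * real s * R * \<bar>w (Suc i)\<bar>" by blast
      moreover have "2 * real s * R * \<bar>w (Suc i)\<bar> \<le> max 1 (2 * real s * R) * \<bar>w (Suc i)\<bar>"
        by (intro mult_right_mono) auto
      ultimately show ?thesis by (intro coord[of i]) linarith+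
    qed
  qed
qed

subsection \<open>Residuals away from zero, and proportional rows\<close>

text \<open>Boxes of integer radius exhaust the space, so null sets may be treated in one box at a
  time, where slabs have controlled measure.\<close>

lemma AE_euclidI:
  assumes "\<And>R. 1 \<le> R \<Longrightarrow> AE x in euclid s. x \<in> cbox_fun s R \<longrightarrow> P x"
  shows "AE x in euclid s. P x"
proof -
  have "AE x in euclid s. \<forall>k::nat. x \<in> cbox_fun s (real (Suc k)) \<longrightarrow> P x"
    unfolding AE_all_countable by (intro allI assms) simp
  then show ?thesis
  proof (rule AE_mp, intro AE_I2 impI)
    fix x assume x: "x \<in> space (euclid s)" and *: "\<forall>k::nat. x \<in> cbox_fun s (real (Suc k)) \<longrightarrow> P x"
    obtain k :: nat where k: "(\<Sum>i<s. \<bar>x i\<bar>) < real k" using reals_Archimedean2 by blast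
    have "\<bar>x i\<bar> \<le> real (Suc k)" if "i < s" for i
    proof -
      have "\<bar>x i\<bar> \<le> (\<Sum>i<s. \<bar>x i\<bar>)" using that by (intro member_le_sum) auto
      then show ?thesis using k by simp
    qed
    then have "x \<in> cbox_fun s (real (Suc k))"
      using x by (simp add: mem_cbox_fun_iff euclid_def space_PiM PiE_iff)
    then show "P x" using * by blast
  qed
qed

text \<open>Within a box the zero set lies in the slab of every width \<open>d > 0\<close>, whose
  measure is at most a constant times \<open>d\<close>.\<close>

lemma AE_aff_nonzero:
  assumes w: "0 < supnorm (s + 1) w"
  shows "AE x in euclid s. aff s w x \<noteq> 0"
proof (rule AE_euclidI)
  fix R :: real assume R: "1 \<le> R"
  define Z where "Z = {x \<in> space (euclid s). x \<in> cbox_fun s R \<and> aff s w x = 0}"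
  have Zm: "Z \<in> sets (euclid s)" unfolding Z_def by measurable
  define C where "C = (2 * R) ^ s * (2 + 2 * real s) / supnorm (s + 1) w"
  have C: "0 < C" unfolding C_def using w R by (intro divide_pos_pos mult_pos_pos) auto
  have le: "emeasure (euclid s) Z \<le> ennreal (C * d)" if d: "0 < d" for d
  proof -
    have "emeasure (euclid s) Z \<le> emeasure (euclid s) (slab s R w d)"
      using d by (intro emeasure_mono sets_slab) (auto simp: Z_def slab_def)
    also have "\<dots> \<le> ennreal (C * d)" using slab_bound[OF R w d] by (simp add: C_def)
    finally show ?thesis .
  qed
  have "emeasure (euclid s) Z \<le> 0"
  proof (rule ennreal_le_epsilon)
    fix e :: real assume "0 < e"
    then show "emeasure (euclid s) Z \<le> 0 + ennreal e" using le[of "e / C"] C by simp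
  qed
  then have "Z \<in> null_sets (euclid s)" using Zm by (auto simp: null_sets_def)
  then show "AE x in euclid s. x \<in> cbox_fun s R \<longrightarrow> aff s w x \<noteq> 0"
    by (rule AE_I') (auto simp: Z_def)
qed

lemma card_int_ball_le:
  fixes t B :: real
  assumes "0 \<le> B"
  shows "finite {p::int. \<bar>t + of_int p\<bar> < B}" "real (card {p::int. \<bar>t + of_int p\<bar> < B}) \<le> 2 * B + 1"
proof -
  let ?J = "{\<lceil>- t - B\<rceil>..\<lfloor>- t + B\<rfloor>}"
  have sub: "{p::int. \<bar>t + of_int p\<bar> < B} \<subseteq> ?J"
    by (auto simp: le_floor_iff ceiling_le_iff abs_less_iff)
  then show "finite {p::int. \<bar>t + of_int p\<bar> < B}" by (rule finite_subset) simp
  have "card {p::int. \<bar>t + of_int p\<bar> < B} \<le> card ?J" using sub by (intro card_mono) auto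
  also have "real (card ?J) \<le> 2 * B + 1"
    using assms by (simp add: of_nat_nat) linarith
  finally show "real (card {p::int. \<bar>t + of_int p\<bar> < B}) \<le> 2 * B + 1" by simp
qed

text \<open>The bound is uniform in \<open>q\<close> although \<open>p\<close> ranges over
  infinitely many integers. A residual with large linear part admits many \<open>p\<close> whose
  slab meets the box, but those slabs are thin in the same proportion.\<close>

lemma emeasure_far_le:
  assumes R: "1 \<le> R" and e: "0 < e" and d: "0 < d" "d \<le> 1"
  shows "emeasure (euclid s) (\<Union>p\<in>{p. e \<le> supnorm (s + 1) (resid s n A q p)}. slab s R (resid s n A q p) d)
    \<le> ennreal ((2 * R) ^ s * (2 + 2 * real s) * (3 / e + 2 * R * (real s + 1)) * d)"
proof -
  let ?w = "resid s n A q"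
  define C where "C = (2 * R) ^ s * (2 + 2 * real s)"
  \<comment> \<open>\<open>T\<close> measures the linear part of the residual, which does not depend
    on \<open>p\<close>. At most \<open>3 + 2 * R * T\<close> shifts matter, and \<open>b\<close>, a
    lower bound for the norms that occur, is at least \<open>T / (real s + 1)\<close>.\<close>
  define T where "T = (\<Sum>i<s. \<bar>?w 0 (Suc i)\<bar>)"
  define F where "F = {p::int. \<bar>?w 0 0 + of_int p\<bar> < 1 + R * T}"
  define b where "b = max e (T / (real s + 1))"
  have C: "0 \<le> C" using R by (simp add: C_def)
  have T: "0 \<le> T" by (simp add: T_def sum_nonneg)
  have b: "0 < b" using e by (simp add: b_def)
  have F: "finite F" "real (card F) \<le> 2 * (1 + R * T) + 1"
    unfolding F_def using card_int_ball_le[of "1 + R * T" "?w 0 0"] R T by auto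
  let ?P = "{p \<in> F. e \<le> supnorm (s + 1) (?w p)}"
  \<comment> \<open>On the box the linear part is at most \<open>R * T\<close> and the form is below
    \<open>d \<le> 1\<close>, which confines the constant term.\<close>
  have inF: "p \<in> F" if x: "x \<in> slab s R (?w p) d" for x p
  proof -
    have "\<bar>x i\<bar> \<le> R" if "i < s" for i
      using x that by (simp add: slab_def mem_cbox_fun_iff)
    then have "(\<Sum>i<s. \<bar>x i\<bar> * \<bar>?w p (Suc i)\<bar>) \<le> (\<Sum>i<s. R * \<bar>?w p (Suc i)\<bar>)"
      by (intro sum_mono mult_right_mono) auto
    also have "\<dots> = R * T"
      unfolding T_def sum_distrib_left using resid_Suc by metis
    finally have "\<bar>\<Sum>i<s. x i * ?w p (Suc i)\<bar> \<le> R * T"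
      using sum_abs[of "\<lambda>i. x i * ?w p (Suc i)" "{..<s}"] by (simp add: abs_mult)
    moreover have "\<bar>?w p 0 + (\<Sum>i<s. x i * ?w p (Suc i))\<bar> < d" using x by (simp add: slab_def aff_def)
    ultimately have "\<bar>?w p 0\<bar> < 1 + R * T" using d by linarith
    then show ?thesis unfolding F_def using resid_0[of s n A q p] by simp
  qed
  have each: "emeasure (euclid s) (slab s R (?w p) d) \<le> ennreal (C * d / b)" if p: "p \<in> ?P" for p
  proof -
    have "T \<le> (\<Sum>i<s. supnorm (s + 1) (?w p))"
      unfolding T_def
    proof (rule sum_mono)
      fix i assume "i \<in> {..<s}"
      then show "\<bar>?w 0 (Suc i)\<bar> \<le> supnorm (s + 1) (?w p)"
        using abs_le_supnorm[of "Suc i" "s + 1" "?w p"] resid_Suc[of s n A q 0 i p] by simp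
    qed
    also have "\<dots> \<le> (real s + 1) * supnorm (s + 1) (?w p)"
      using supnorm_nonneg[of "s + 1" "?w p"] by (simp add: distrib_right)
    finally have "T / (real s + 1) \<le> supnorm (s + 1) (?w p)" by (simp add: field_simps)
    then have bw: "b \<le> supnorm (s + 1) (?w p)" using p by (simp add: b_def)
    have "emeasure (euclid s) (slab s R (?w p) d) \<le> ennreal (C * d / supnorm (s + 1) (?w p))"
      unfolding C_def using b bw d R by (intro slab_bound) auto
    also have "\<dots> \<le> ennreal (C * d / b)"
      using b bw C d by (intro ennreal_leI divide_left_mono) auto
    finally show ?thesis .
  qed
  have "(\<Union>p\<in>{p. e \<le> supnorm (s + 1) (?w p)}. slab s R (?w p) d) = (\<Union>p\<in>?P. slab s R (?w p) d)"
    using inF by blast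
  then have "emeasure (euclid s) (\<Union>p\<in>{p. e \<le> supnorm (s + 1) (?w p)}. slab s R (?w p) d)
      = emeasure (euclid s) (\<Union>p\<in>?P. slab s R (?w p) d)" by (rule arg_cong)
  also have "\<dots> \<le> (\<Sum>p\<in>?P. emeasure (euclid s) (slab s R (?w p) d))"
    using F by (intro emeasure_subadditive_finite) auto
  also have "\<dots> \<le> (\<Sum>p\<in>?P. ennreal (C * d / b))" by (rule sum_mono) (rule each)
  also have "\<dots> = ennreal (real (card ?P) * (C * d / b))"
    unfolding sum_constant ennreal_of_nat_eq_real_of_nat
    by (rule ennreal_mult[symmetric]) (use C d b in auto)
  also have "\<dots> \<le> ennreal (C * (3 / e + 2 * R * (real s + 1)) * d)"
  proof (rule ennreal_leI)
    have "real (card ?P) \<le> real (card F)" using F by (intro of_nat_mono card_mono) auto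
    then have "real (card ?P) \<le> 3 + 2 * R * T" using F(2) by simp
    then have "real (card ?P) / b \<le> (3 + 2 * R * T) / b" using b by (intro divide_right_mono) auto
    also have "\<dots> = 3 / b + 2 * R * (T / b)" by (simp add: add_divide_distrib)
    also have "\<dots> \<le> 3 / e + 2 * R * (real s + 1)"
    proof (intro add_mono mult_left_mono divide_left_mono)
      have "T / (real s + 1) \<le> b" by (simp add: b_def)
      then show "T / b \<le> real s + 1" using b by (simp add: field_simps)
    qed (use R e b in \<open>auto simp: b_def\<close>)
    finally have "C * d * (real (card ?P) / b) \<le> C * d * (3 / e + 2 * R * (real s + 1))"
      using C d by (intro mult_left_mono) auto
    then show "real (card ?P) * (C * d / b) \<le> C * (3 / e + 2 * R * (real s + 1)) * d"
      by (simp add: mult_ac)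
  qed
  finally show ?thesis unfolding C_def .
qed

text \<open>Borel-Cantelli over \<open>q\<close> alone: the union over \<open>p\<close> costs only a
  constant, and the heights to the power \<open>-v\<close> are summable because
  \<open>v > n\<close>.\<close>

lemma AE_finite_far:
  assumes sn: "s < n" and v: "real n < v" and e: "0 < e"
  shows "AE x in euclid s. finite {q \<in> int_vecs n. \<exists>p. e \<le> supnorm (s + 1) (resid s n A q p)
    \<and> \<bar>aff s (resid s n A q p) x\<bar> < hgt n q powr (- v)}"
proof (rule AE_euclidI)
  fix R :: real assume R: "1 \<le> R"
  let ?w = "resid s n A"
  let ?I = "int_vecs n - {\<lambda>_. 0}"
  define E where "E q = (\<Union>p\<in>{p. e \<le> supnorm (s + 1) (?w q p)}. slab s R (?w q p) (hgt n q powr (- v)))" for q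
  define K where "K = (2 * R) ^ s * (2 + 2 * real s) * (3 / e + 2 * R * (real s + 1))"
  have "AE x in euclid s. finite {q \<in> ?I. x \<in> E q}"
  proof (rule AE_finite_of_summable)
    show "countable ?I" using countable_int_vecs by blast
    show "E q \<in> sets (euclid s)" for q unfolding E_def by (intro sets.countable_UN'') auto
    show "(\<lambda>q. K * hgt n q powr (- v)) summable_on ?I"
      using sn v by (intro summable_on_cmult_right summable_on_hgt_powr) auto
    fix q assume "q \<in> ?I"
    then have h: "1 \<le> hgt n q" by (intro hgt_ge_1) auto
    then have "hgt n q powr (- v) \<le> 1"
      using v by (auto simp: powr_minus inverse_le_1_iff intro: ge_one_powr_ge_zero)
    then show "emeasure (euclid s) (E q) \<le> ennreal (K * hgt n q powr (- v))"
      unfolding E_def K_def using R e h by (intro emeasure_far_le) auto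
    show "0 \<le> K * hgt n q powr (- v)" using R e by (simp add: K_def)
  qed
  then show "AE x in euclid s. x \<in> cbox_fun s R \<longrightarrow> finite {q \<in> int_vecs n.
    \<exists>p. e \<le> supnorm (s + 1) (?w q p) \<and> \<bar>aff s (?w q p) x\<bar> < hgt n q powr (- v)}"
  proof (rule AE_mp, intro AE_I2 impI)
    fix x assume fin: "finite {q \<in> ?I. x \<in> E q}" and x: "x \<in> cbox_fun s R"
    \<comment> \<open>The zero vector satisfies no strict inequality here, as
      \<open>0 powr (- v) = 0\<close>; dropping it from the index set loses nothing.\<close>
    have "hgt n (\<lambda>_. 0) = 0" using sn by (intro hgt_zero) auto
    then have "{q \<in> int_vecs n. \<exists>p. e \<le> supnorm (s + 1) (?w q p) \<and> \<bar>aff s (?w q p) x\<bar> < hgt n q powr (- v)}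
        \<subseteq> {q \<in> ?I. x \<in> E q}"
      using x by (auto simp: E_def slab_def)
    then show "finite {q \<in> int_vecs n. \<exists>p. e \<le> supnorm (s + 1) (?w q p) \<and> \<bar>aff s (?w q p) x\<bar> < hgt n q powr (- v)}"
      using fin by (rule finite_subset)
  qed
qed

section \<open>Uniqueness of small residuals, and proportional rows\<close>

lemma near_unique:
  assumes sn: "s < n" and q: "q \<in> int_vecs n" "q' \<in> int_vecs n"
    and tail: "\<And>j. q (s + j) = q' (s + j)"
    and near: "supnorm (s + 1) (resid s n A q p) < 1 / 2" "supnorm (s + 1) (resid s n A q' p') < 1 / 2"
  shows "q = q'"
proof
  fix j
  show "q j = q' j"
  proof (cases "j < s")
    case True
    \<comment> \<open>With equal tails the contribution of \<open>A\<close> cancels, and an integer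
      that is the difference of two numbers below 1/2 in absolute value is 0.\<close>
    have "resid s n A q p (Suc j) - resid s n A q' p' (Suc j) = of_int (q j - q' j)"
      by (simp add: resid_def err_def tail)
    moreover have "\<bar>resid s n A q p (Suc j)\<bar> < 1 / 2" "\<bar>resid s n A q' p' (Suc j)\<bar> < 1 / 2"
      using near True abs_le_supnorm[of "Suc j" "s + 1" "resid s n A q p"]
        abs_le_supnorm[of "Suc j" "s + 1" "resid s n A q' p'"] by linarith+
    ultimately have "\<bar>of_int (q j - q' j)\<bar> < (1::real)" by linarith
    then have "\<bar>q j - q' j\<bar> < 1" by linarith
    then show ?thesis by simp
  next
    case False
    then show ?thesis using tail[of "j - s"] by simp
  qed
qed

text \<open>With zero tail, uniqueness would identify \<open>q\<close> with the zero vector, whose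
  residual for \<open>p = 0\<close> vanishes.\<close>

lemma near_tail_nonzero:
  assumes "s < n" "q \<in> int_vecs n" "q \<noteq> (\<lambda>_. 0)" "supnorm (s + 1) (resid s n A q p) < 1 / 2"
  shows "(\<lambda>j. q (s + j)) \<noteq> (\<lambda>_. 0)"
proof
  assume "(\<lambda>j. q (s + j)) = (\<lambda>_. 0)"
  then have tail: "q (s + j) = 0" for j by (rule fun_cong)
  have "resid s n A (\<lambda>_. 0) 0 i = 0" for i
    by (simp add: resid_def err_def split: nat.split)
  then have "supnorm (s + 1) (resid s n A (\<lambda>_. 0) 0) < 1 / 2"
    using supnorm_attained[of "s + 1" "resid s n A (\<lambda>_. 0) 0"] by auto
  then have "q = (\<lambda>_. 0)"
    using assms tail by (intro near_unique[of s n q "\<lambda>_. 0" A p 0]) (auto simp: int_vecs_def)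
  then show False using assms by blast
qed

lemma common_denominator:
  assumes "\<forall>i<k::nat. r i \<in> (\<rat> :: real set)"
  shows "\<exists>D::int. D > 0 \<and> (\<forall>i<k. \<exists>u::int. of_int D * r i = of_int u)"
  using assms
proof (induction k)
  case 0
  show ?case by (intro exI[of _ 1]) auto
next
  case (Suc k)
  then obtain D :: int where D: "D > 0" "\<forall>i<k. \<exists>u::int. of_int D * r i = of_int u" by auto
  have "r k \<in> \<rat>" using Suc by simp
  then obtain a b :: int where ab: "b > 0" "r k = of_int a / of_int b"
    by (metis Rats_cases')
  have "\<exists>u::int. of_int (D * b) * r i = of_int u" if i: "i < Suc k" for i
  proof (cases "i = k")
    case True
    then show ?thesis using ab by (intro exI[of _ "D * a"]) simp
  next
    case False
    then obtain u :: int where "of_int D * r i = of_int u" using D i by (metis less_SucE)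
    then have "of_int (D * b) * r i = of_int (b * u)" by (simp add: mult_ac)
    then show ?thesis by blast
  qed
  then show ?case using D ab by (intro exI[of _ "D * b"]) auto
qed

text \<open>With \<open>D\<close> a common denominator of \<open>r\<close>, the number \<open>D w\<^sub>i - D r\<^sub>i w\<^sub>i\<^sub>0\<close> is an integer, hence \<open>0\<close> once \<open>w\<close> is small.\<close>
lemma near_parallel:
  assumes r: "\<forall>i<s + 1. r i \<in> \<rat>" and i0: "i0 < s + 1" "r i0 = 1"
    and A: "\<forall>i<s + 1. \<forall>j<n - s. A i j = r i * A i0 j"
  obtains e where "0 < e" "e \<le> 1 / 2"
    "\<And>q p i. supnorm (s + 1) (resid s n A q p) < e \<Longrightarrow> i < s + 1
      \<Longrightarrow> resid s n A q p i = r i * resid s n A q p i0"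
proof -
  obtain D :: int where D: "D > 0" and "\<forall>i<s + 1. \<exists>u::int. of_int D * r i = of_int u"
    using common_denominator[OF r] by blast
  then obtain u where u: "\<And>i. i < s + 1 \<Longrightarrow> of_int D * r i = of_int (u i :: int)" by metis
  define U where "U = (\<Sum>i<s+1. \<bar>u i\<bar>)"
  have U: "0 \<le> U" by (simp add: U_def sum_nonneg)
  \<comment> \<open>Chosen so that \<open>(D + U) * e < 1\<close>; since \<open>D \<ge> 1\<close>,
    the added \<open>1\<close> also gives \<open>e \<le> 1 / 2\<close>.\<close>
  define e where "e = 1 / (of_int D + of_int U + 1 :: real)"
  have D1: "1 \<le> real_of_int D" "0 \<le> real_of_int U" using D U by auto
  show thesis
  proof (rule that)
    show e: "0 < e" "e \<le> 1 / 2" using D1 by (auto simp: e_def field_simps)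
    fix q p i
    assume near: "supnorm (s + 1) (resid s n A q p) < e" and i: "i < s + 1"
    let ?w = "resid s n A q p"
    let ?P = "case_nat p q"
    define t where "t = (\<Sum>j<n - s. A i0 j * of_int (q (s + j)))"
    have w: "?w k = r k * t + of_int (?P k)" if "k < s + 1" for k
      using A that by (simp add: resid_def err_def t_def sum_distrib_left mult.assoc)
    have "of_int D * ?w i - of_int (u i) * ?w i0
        = (of_int D * r i - of_int (u i)) * t + (of_int D * of_int (?P i) - of_int (u i) * of_int (?P i0))"
      unfolding w[OF i] w[OF i0(1)] i0(2) by (simp add: algebra_simps)
    then have int: "of_int D * ?w i - of_int (u i) * ?w i0 = of_int (D * ?P i - u i * ?P i0)"
      using u[OF i] by simp
    have "\<bar>u i\<bar> \<le> U" unfolding U_def using i by (intro member_le_sum) auto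
    then have uU: "\<bar>real_of_int (u i)\<bar> \<le> of_int U" by linarith
    have "\<bar>?w i\<bar> \<le> e" "\<bar>?w i0\<bar> \<le> e" using near i i0 by (auto simp: supnorm_less_iff intro: less_imp_le)
    then have "\<bar>of_int D * ?w i\<bar> \<le> of_int D * e" "\<bar>of_int (u i) * ?w i0\<bar> \<le> of_int U * e"
      unfolding abs_mult using D1 uU by (auto intro!: mult_mono)
    then have "\<bar>of_int D * ?w i - of_int (u i) * ?w i0\<bar> \<le> (of_int D + of_int U) * e"
      by (simp add: distrib_right)
    also have "\<dots> < 1" using D1 by (simp add: e_def field_simps)
    finally have "\<bar>D * ?P i - u i * ?P i0\<bar> < 1" unfolding int by linarith
    then have "of_int D * ?w i = of_int D * r i * ?w i0" using int u[OF i] by simp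
    then show "?w i = r i * ?w i0" using D by (simp add: mult.assoc)
  qed
qed

text \<open>Outside the null set where \<open>aff s r x = 0\<close>, a small residual is a multiple
  of \<open>r\<close>, so its value at \<open>x\<close> is comparable to its norm. If the tail is
  not in the finite approximation set, that norm is at least the height of the tail to the power
  \<open>-w\<close>, and \<open>w < v\<close> then bounds the height.\<close>

lemma AE_finite_near_rows:
  assumes sn: "s < n" and r: "\<forall>i<s + 1. r i \<in> \<rat>" and i0: "i0 < s + 1" "r i0 = 1"
    and A: "\<forall>i<s + 1. \<forall>j<n - s. A i j = r i * A i0 j"
    and fin: "finite (approx_set (s + 1) (n - s) A w)" and wv: "w < v" "0 \<le> v"
  obtains e where "0 < e"
    "AE x in euclid s. finite {q \<in> int_vecs n. \<exists>p. supnorm (s + 1) (resid s n A q p) < e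
      \<and> \<bar>aff s (resid s n A q p) x\<bar> < hgt n q powr (- v)}"
proof -
  obtain e where e: "0 < e" "e \<le> 1 / 2"
    and par: "\<And>q p i. supnorm (s + 1) (resid s n A q p) < e \<Longrightarrow> i < s + 1
      \<Longrightarrow> resid s n A q p i = r i * resid s n A q p i0"
    using near_parallel[OF r i0 A] by metis
  define l where "l = n - s"
  have l: "0 < l" using sn by (simp add: l_def)
  define B where "B = supnorm (s + 1) r"
  have B: "0 < B" using abs_le_supnorm[OF i0(1), of r] i0(2) by (simp add: B_def)
  have "AE x in euclid s. finite {q \<in> int_vecs n. \<exists>p. supnorm (s + 1) (resid s n A q p) < e
      \<and> \<bar>aff s (resid s n A q p) x\<bar> < hgt n q powr (- v)}"
    using AE_aff_nonzero[OF B[unfolded B_def]]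
  proof (rule AE_mp, intro AE_I2 impI)
    fix x assume \<rho>: "aff s r x \<noteq> 0"
    let ?N = "{q \<in> int_vecs n. \<exists>p. supnorm (s + 1) (resid s n A q p) < e
      \<and> \<bar>aff s (resid s n A q p) x\<bar> < hgt n q powr (- v)}"
    let ?tail = "\<lambda>q j. q (s + j) :: int"
    \<comment> \<open>A tail outside the approximation set will satisfy
      \<open>hgt l q powr (v - w) \<le> B / |aff s r x|\<close>; \<open>H\<close> solves this for
      the height.\<close>
    define H where "H = (B / \<bar>aff s r x\<bar>) powr (1 / (v - w))"
    have "?tail ` ?N \<subseteq> approx_set (s + 1) l A w \<union> {q \<in> int_vecs l. hgt l q \<le> H}"
    proof (rule image_subsetI)
      fix q assume q: "q \<in> ?N"
      then obtain p where qn: "q \<in> int_vecs n" and near: "supnorm (s + 1) (resid s n A q p) < e"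
        and small: "\<bar>aff s (resid s n A q p) x\<bar> < hgt n q powr (- v)" by blast
      have tl: "?tail q \<in> int_vecs l" using qn by (auto simp: int_vecs_def l_def)
      have "q \<noteq> (\<lambda>_. 0)" using small hgt_zero[of n] sn by auto
      then have h: "1 \<le> hgt l (?tail q)"
        using near_tail_nonzero[of s n q A p] sn qn near e(2) tl by (intro hgt_ge_1) auto
      have hle: "hgt l (?tail q) \<le> hgt n q"
        unfolding supnorm_le_iff[OF l] using abs_le_supnorm[of _ n "\<lambda>j. of_int (q j)"] by (auto simp: l_def)
      let ?w = "resid s n A q p"
      show "?tail q \<in> approx_set (s + 1) l A w \<union> {q \<in> int_vecs l. hgt l q \<le> H}"
      proof (cases "?tail q \<in> approx_set (s + 1) l A w")
        case False
        then have "hgt l (?tail q) powr (- w) \<le> supnorm (s + 1) ?w"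
          using tl unfolding approx_set_def resid_def l_def by (auto simp: not_less)
        also have "\<dots> \<le> B * \<bar>?w i0\<bar>"
          unfolding B_def using par[OF near] abs_le_supnorm[of _ "s + 1" r]
          by (subst supnorm_le_iff) (auto simp: abs_mult intro!: mult_right_mono)
        finally have 1: "hgt l (?tail q) powr (- w) \<le> B * \<bar>?w i0\<bar>" .
        have "aff s ?w x = ?w i0 * aff s r x"
          unfolding aff_def using par[OF near] by (simp add: distrib_left sum_distrib_left mult_ac)
        then have "\<bar>?w i0\<bar> * \<bar>aff s r x\<bar> < hgt n q powr (- v)" using small by (simp add: abs_mult)
        also have "\<dots> \<le> hgt l (?tail q) powr (- v)" using hle h wv by (intro powr_mono2') auto
        finally have "B * (\<bar>?w i0\<bar> * \<bar>aff s r x\<bar>) \<le> B * hgt l (?tail q) powr (- v)"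
          using B by (intro mult_left_mono) auto
        moreover have "hgt l (?tail q) powr (- w) * \<bar>aff s r x\<bar> \<le> B * \<bar>?w i0\<bar> * \<bar>aff s r x\<bar>"
          using 1 by (intro mult_right_mono) auto
        ultimately have "hgt l (?tail q) powr (- w) * \<bar>aff s r x\<bar> \<le> B * hgt l (?tail q) powr (- v)"
          by (simp add: mult.assoc)
        then have "hgt l (?tail q) powr (v - w) \<le> B / \<bar>aff s r x\<bar>"
          using \<rho> h by (simp add: powr_minus powr_diff field_simps)
        then have "(hgt l (?tail q) powr (v - w)) powr (1 / (v - w)) \<le> H"
          unfolding H_def using wv by (intro powr_mono2) auto
        then show ?thesis using h wv tl by (simp add: powr_powr)
      qed auto
    qed
    then have "finite (?tail ` ?N)"
      by (rule finite_subset) (use fin finite_int_vecs_bounded[OF l] in \<open>simp add: l_def\<close>)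
    moreover have "inj_on ?tail ?N"
    proof (rule inj_onI)
      fix q q' assume q: "q \<in> ?N" "q' \<in> ?N" and eq: "?tail q = ?tail q'"
      then obtain p p' where "supnorm (s + 1) (resid s n A q p) < e" "supnorm (s + 1) (resid s n A q' p') < e"
        by blast
      then show "q = q'"
        using sn q e(2) fun_cong[OF eq] by (intro near_unique[of s n q q' A p p']) auto
    qed
    ultimately show "finite ?N" by (rule finite_imageD)
  qed
  with e(1) show thesis by (rule that)
qed

subsection \<open>A single column\<close>

text \<open>The map \<open>m \<mapsto> \<lfloor>m / g\<rfloor>\<close> is injective on \<open>S\<close> with positive values.\<close>
lemma sum_powr_separated_le:
  fixes S :: "nat set"
  assumes g: "0 < g" and v: "1 < v"
    and first: "\<And>m. m \<in> S \<Longrightarrow> g \<le> real m"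
    and gap: "\<And>m m'. m \<in> S \<Longrightarrow> m' \<in> S \<Longrightarrow> m' < m \<Longrightarrow> g \<le> real (m - m')"
    and F: "finite F" "F \<subseteq> S"
  shows "(\<Sum>m\<in>F. real m powr (- v)) \<le> g powr (- v) * (\<Sum>k. real k powr (- v))"
proof -
  define h where "h m = nat \<lfloor>real m / g\<rfloor>" for m
  have h: "real (h m) \<le> real m / g" "real m / g < real (h m) + 1" for m
    unfolding h_def using g by (auto simp: of_nat_nat)
  have h_less: "h m' < h m" if "m \<in> S" "m' \<in> S" "m' < m" for m m'
  proof -
    have "g \<le> real m - real m'" using gap[OF that] that(3) by (simp add: of_nat_diff)
    then have "1 \<le> real m / g - real m' / g" using g by (simp add: field_simps)
    then have "real (h m') < real (h m)" using h[of m] h[of m'] by linarith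
    then show ?thesis by simp
  qed
  have inj: "inj_on h F"
    using F h_less by (intro linorder_inj_onI) (auto dest: less_imp_neq)
  have h1: "1 \<le> h m" if "m \<in> S" for m
  proof -
    have "1 \<le> real m / g" using first[OF that] g by simp
    then show ?thesis using h(2)[of m] by linarith
  qed
  have "(\<Sum>m\<in>F. real m powr (- v)) \<le> (\<Sum>m\<in>F. g powr (- v) * real (h m) powr (- v))"
  proof (rule sum_mono)
    fix m assume "m \<in> F"
    then have 1: "1 \<le> h m" using F h1 by blast
    have "g * real (h m) \<le> real m" using h(1)[of m] g by (simp add: field_simps)
    then have "real m powr (- v) \<le> (g * real (h m)) powr (- v)"
      using 1 g v by (intro powr_mono2') auto
    then show "real m powr (- v) \<le> g powr (- v) * real (h m) powr (- v)"
      using g by (simp add: powr_mult)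
  qed
  also have "\<dots> = g powr (- v) * (\<Sum>k\<in>h ` F. real k powr (- v))"
    by (simp add: sum_distrib_left sum.reindex[OF inj])
  also have "\<dots> \<le> g powr (- v) * (\<Sum>k. real k powr (- v))"
    using F v by (intro mult_left_mono sum_le_suminf) (auto simp: summable_real_powr_iff)
  finally show ?thesis .
qed

text \<open>The witness precedes the least \<open>k\<close> with \<open>(1 / 2) ^ k \<le> t\<close>.
  The bound \<open>t < 1 / 2\<close> gives \<open>1 \<le> j\<close>, so that
  \<open>(1 / 2) ^ j \<le> 1 / 2\<close>, where the integer part of an approximation is
  unique.\<close>

lemma dyadic_scale:
  fixes t :: real
  assumes "0 < t" "t < 1 / 2"
  obtains j where "1 \<le> j" "(1 / 2) ^ Suc j \<le> t" "t < (1 / 2) ^ j"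
proof -
  define k where "k = (LEAST k. (1 / 2) ^ k \<le> t)"
  have "\<exists>k'. (1 / 2) ^ k' < t" by (rule real_arch_pow_inv[OF assms(1)]) simp
  then obtain k' where "(1 / 2) ^ k' < t" ..
  then have k: "(1 / 2) ^ k \<le> t"
    unfolding k_def by (intro LeastI[of "\<lambda>k. (1 / 2) ^ k \<le> t" k'] less_imp_le)
  have "k \<noteq> 0" "k \<noteq> 1" using k assms by (intro notI; simp)+
  then obtain j where j: "k = Suc j" "1 \<le> j" by (cases k) auto
  then have "\<not> (1 / 2) ^ j \<le> t" using not_less_Least[of j "\<lambda>k. (1 / 2) ^ k \<le> t"] by (simp add: k_def[symmetric])
  then show thesis using j k by (intro that[of j]) auto
qed

text \<open>The error for a single column \<open>a\<close> and a natural multiplier; negative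
  multipliers are reduced to these by a change of sign.\<close>

definition colerr :: "(nat \<Rightarrow> real) \<Rightarrow> nat \<Rightarrow> (nat \<Rightarrow> int) \<Rightarrow> nat \<Rightarrow> real" where
  "colerr a m P = (\<lambda>i. a i * real m + of_int (P i))"

lemma colerr_diff: "m' \<le> m \<Longrightarrow> colerr a m P i - colerr a m' P' i = colerr a (m - m') (\<lambda>i. P i - P' i) i"
  by (simp add: colerr_def of_nat_diff algebra_simps)

text \<open>The lower bound \<open>low\<close> solved for \<open>m\<close>. Applied to differences
  of two multipliers, it bounds the gaps between good ones from below.\<close>

lemma near_points_separated:
  assumes c: "0 < c" and w: "0 < w"
    and low: "\<And>m P. 1 \<le> m \<Longrightarrow> c * real m powr (- w) \<le> supnorm (s + 1) (colerr a m P)"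
    and m: "1 \<le> m" and small: "supnorm (s + 1) (colerr a m P) \<le> d" and d: "0 < d"
  shows "(c / d) powr (1 / w) \<le> real m"
proof -
  have "c * real m powr (- w) \<le> d" using low[OF m, of P] small by linarith
  then have "c / d \<le> real m powr w" using m d by (simp add: powr_minus field_simps)
  then have "(c / d) powr (1 / w) \<le> (real m powr w) powr (1 / w)"
    using c d w by (intro powr_mono2) auto
  then show ?thesis using w by (simp add: powr_powr)
qed

text \<open>The weight \<open>2 ^ Suc j\<close> bounds the reciprocal norm at scale
  \<open>j\<close>. Gaps of order \<open>2 powr (j / w)\<close> in \<open>S j\<close> make the sum
  of the \<open>real m powr (- v)\<close> of order \<open>2 powr (- j * v / w)\<close>, so a
  geometric series dominates because \<open>w < v\<close>.\<close>

lemma summable_on_near_points: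
  fixes S :: "nat \<Rightarrow> nat set"
  assumes c: "0 < c" and w: "0 < w" "w < v" and v: "1 < v"
    and low: "\<And>m P. 1 \<le> m \<Longrightarrow> c * real m powr (- w) \<le> supnorm (s + 1) (colerr a m P)"
    and S: "S = (\<lambda>j. {m. 1 \<le> m \<and> (\<exists>P. supnorm (s + 1) (colerr a m P) < (1 / 2) ^ j)})"
  shows "(\<lambda>(j, m). 2 ^ Suc j * real m powr (- v)) summable_on Sigma UNIV S"
proof -
  define Z where "Z = (\<Sum>k. real k powr (- v))"
  \<comment> \<open>The factor 2 allows for a difference of two elements of \<open>S j\<close>,
    whose error can reach twice the scale.\<close>
  define g where "g j = (c / (2 * (1 / 2) ^ j)) powr (1 / w)" for j :: nat
  have g: "0 < g j" for j using c by (simp add: g_def)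
  have first: "g j \<le> real m" if mS: "m \<in> S j" for j m
  proof -
    obtain P where "1 \<le> m" "supnorm (s + 1) (colerr a m P) < (1 / 2) ^ j" using mS unfolding S by blast
    moreover have "(1 / 2 :: real) ^ j \<le> 2 * (1 / 2) ^ j" by simp
    ultimately show ?thesis
      unfolding g_def using near_points_separated[OF c w(1) low, of m P "2 * (1 / 2) ^ j"] by simp
  qed
  have gap: "g j \<le> real (m - m')" if mS: "m \<in> S j" "m' \<in> S j" and less: "m' < m" for j m m'
  proof -
    obtain P P' where P: "supnorm (s + 1) (colerr a m P) < (1 / 2) ^ j"
      "supnorm (s + 1) (colerr a m' P') < (1 / 2) ^ j" using mS unfolding S by blast
    have "\<bar>colerr a (m - m') (\<lambda>i. P i - P' i) i\<bar> \<le> 2 * (1 / 2) ^ j" if i: "i < s + 1" for i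
      using colerr_diff[of m' m a P i P'] less P
        abs_le_supnorm[OF i, of "colerr a m P"] abs_le_supnorm[OF i, of "colerr a m' P'"] by linarith
    then have "supnorm (s + 1) (colerr a (m - m') (\<lambda>i. P i - P' i)) \<le> 2 * (1 / 2) ^ j"
      by (simp add: supnorm_le_iff)
    then show ?thesis
      unfolding g_def using near_points_separated[OF c w(1) low, of "m - m'"] less by simp
  qed
  have fin: "(\<Sum>m\<in>F. 2 ^ Suc j * real m powr (- v)) \<le> 2 ^ Suc j * (g j powr (- v) * Z)"
    if "finite F" "F \<subseteq> S j" for F j
    unfolding sum_distrib_left[symmetric] Z_def
    using sum_powr_separated_le[of "g j" v "S j" F] g v first gap that by (intro mult_left_mono) auto
  have inner: "(\<lambda>m. 2 ^ Suc j * real m powr (- v)) summable_on S j" for j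
    by (rule nonneg_bdd_above_summable_on) (use fin in \<open>auto intro!: bdd_aboveI2\<close>)
  have "(\<lambda>j. infsum (\<lambda>m. 2 ^ Suc j * real m powr (- v)) (S j)) summable_on UNIV"
  proof (rule summable_on_comparison_test)
    define \<rho> where "\<rho> = 2 powr (1 - v / w)"
    define K where "K = 2 * (c / 2) powr (- v / w) * Z"
    have "\<rho> < 2 powr 0" unfolding \<rho>_def using w by (intro powr_less_mono) (auto simp: field_simps)
    then have \<rho>: "0 < \<rho>" "\<rho> < 1" by (auto simp: \<rho>_def)
    have "summable (\<lambda>j. K * \<rho> ^ j)" using \<rho> by (intro summable_mult summable_geometric) auto
    moreover have "0 \<le> K" unfolding K_def Z_def using v
      by (intro mult_nonneg_nonneg suminf_nonneg) (auto simp: summable_real_powr_iff)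
    ultimately show "(\<lambda>j. K * \<rho> ^ j) summable_on UNIV"
      using \<rho> by (intro norm_summable_imp_summable_on) simp
    fix j
    have "g j powr (- v) = (c / 2 * 2 powr real j) powr (- v / w)"
      using w by (simp add: g_def powr_powr power_one_over powr_realpow field_simps)
    also have "\<dots> = (c / 2) powr (- v / w) * 2 powr (real j * (- v / w))"
      using c by (subst powr_mult) (auto simp: powr_powr)
    finally have "2 ^ Suc j * (g j powr (- v) * Z) = K * (2 powr real j * 2 powr (real j * (- v / w)))"
      by (simp add: K_def powr_realpow mult_ac)
    also have "2 powr real j * 2 powr (real j * (- v / w)) = \<rho> ^ j"
      using \<rho> by (simp add: \<rho>_def powr_add[symmetric] powr_realpow[symmetric] powr_powr field_simps)
    finally have eq: "2 ^ Suc j * (g j powr (- v) * Z) = K * \<rho> ^ j" .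
    show "infsum (\<lambda>m. 2 ^ Suc j * real m powr (- v)) (S j) \<le> K * \<rho> ^ j"
      unfolding eq[symmetric] by (rule infsum_le_finite_sums[OF inner fin])
    show "0 \<le> infsum (\<lambda>m. 2 ^ Suc j * real m powr (- v)) (S j)" by (intro infsum_nonneg) auto
  qed
  then show ?thesis
    using inner by (intro summable_on_SigmaI[where g = "\<lambda>j. infsum (\<lambda>m. 2 ^ Suc j * real m powr (- v)) (S j)"]) auto
qed

lemma aff_cong: "(\<And>i. i < s + 1 \<Longrightarrow> w i = w' i) \<Longrightarrow> aff s w = aff s w'"
  by (auto simp: aff_def fun_eq_iff intro!: arg_cong2[where f = "(+)"] sum.cong)

lemma colerr_unique:
  assumes "supnorm (s + 1) (colerr a m P) < 1 / 2" "supnorm (s + 1) (colerr a m P') < 1 / 2" "i < s + 1"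
  shows "P i = P' i"
proof -
  have "\<bar>colerr a m P i\<bar> < 1 / 2" "\<bar>colerr a m P' i\<bar> < 1 / 2"
    using assms abs_le_supnorm[OF assms(3), of "colerr a m P"] abs_le_supnorm[OF assms(3), of "colerr a m P'"]
    by linarith+
  then have "\<bar>real_of_int (P i) - of_int (P' i)\<bar> < 1" unfolding colerr_def by linarith
  then show ?thesis by linarith
qed

text \<open>Borel-Cantelli over pairs of a dyadic scale \<open>j\<close> for the norm and a
  multiplier \<open>m\<close>: the slab has measure at most a constant times
  \<open>2 ^ Suc j * real m powr (- v)\<close>.\<close>

lemma AE_finite_near_multiples:
  assumes c: "0 < c" and w: "0 < w" "w < v" and v: "1 < v"
    and low: "\<And>m P. 1 \<le> m \<Longrightarrow> c * real m powr (- w) \<le> supnorm (s + 1) (colerr a m P)"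
  shows "AE x in euclid s. finite {m. 1 \<le> m \<and> (\<exists>P. supnorm (s + 1) (colerr a m P) < 1 / 2
    \<and> \<bar>aff s (colerr a m P) x\<bar> < real m powr (- v))}"
proof (rule AE_euclidI)
  fix R :: real assume R: "1 \<le> R"
  let ?n = "\<lambda>m P. supnorm (s + 1) (colerr a m P)"
  define S where "S = (\<lambda>j::nat. {m. 1 \<le> m \<and> (\<exists>P. ?n m P < (1 / 2) ^ j)})"
  define I where "I = {(j, m) \<in> Sigma UNIV S. 1 \<le> j}"
  define E where "E = (\<lambda>(j, m). {x. \<exists>P. (1 / 2) ^ Suc j \<le> ?n m P \<and> ?n m P < (1 / 2) ^ j
    \<and> x \<in> slab s R (colerr a m P) (real m powr (- v))})"
  define C where "C = (2 * R) ^ s * (2 + 2 * real s)"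
  have C: "0 \<le> C" using R by (simp add: C_def)
  \<comment> \<open>For \<open>j \<ge> 1\<close> the relevant entries of \<open>P\<close> are
    determined by \<open>m\<close>, so the union over \<open>P\<close> is empty or a single slab:
    measurable and without multiplicity.\<close>
  have Ejm: "E (j, m) = {} \<or> (\<exists>P. (1 / 2) ^ Suc j \<le> ?n m P \<and> E (j, m) = slab s R (colerr a m P) (real m powr (- v)))"
    if j: "1 \<le> j" for j m
  proof (cases "\<exists>P. (1 / 2) ^ Suc j \<le> ?n m P \<and> ?n m P < (1 / 2) ^ j")
    case True
    then obtain P where P: "(1 / 2) ^ Suc j \<le> ?n m P" "?n m P < (1 / 2) ^ j" by blast
    have half: "(1 / 2 :: real) ^ j \<le> 1 / 2" using power_decreasing[OF j, of "1 / 2 :: real"] by simp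
    have "slab s R (colerr a m P') = slab s R (colerr a m P)" if "?n m P' < (1 / 2) ^ j" for P'
    proof -
      have "P' i = P i" if i: "i < s + 1" for i
        by (rule colerr_unique[OF _ _ i, of a m]) (use \<open>?n m P' < _\<close> P half in linarith)+
      then have "aff s (colerr a m P') = aff s (colerr a m P)"
        by (intro aff_cong) (auto simp: colerr_def)
      then show ?thesis by (simp add: slab_def fun_eq_iff)
    qed
    then have "x \<in> E (j, m) \<longleftrightarrow> x \<in> slab s R (colerr a m P) (real m powr (- v))" for x
      using P unfolding E_def case_prod_conv mem_Collect_eq by metis
    then have "E (j, m) = slab s R (colerr a m P) (real m powr (- v))" by blast
    then show ?thesis using P by blast
  qed (auto simp: E_def)
  have "AE x in euclid s. finite {i \<in> I. x \<in> E i}"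
  proof (rule AE_finite_of_summable)
    have "(\<lambda>(j, m). 2 ^ Suc j * real m powr (- v)) summable_on Sigma UNIV S"
      by (rule summable_on_near_points[OF c w v low S_def])
    then have "(\<lambda>(j, m). 2 ^ Suc j * real m powr (- v)) summable_on I"
      by (rule summable_on_subset_banach) (auto simp: I_def)
    then show "(\<lambda>i. C * (case i of (j, m) \<Rightarrow> 2 ^ Suc j * real m powr (- v))) summable_on I"
      by (rule summable_on_cmult_right)
    fix i assume "i \<in> I"
    then obtain j m where i: "i = (j, m)" "1 \<le> j" "m \<in> S j" by (auto simp: I_def)
    have m: "1 \<le> m" using i by (simp add: S_def)
    show "E i \<in> sets (euclid s)" using Ejm[OF i(2), of m] i(1) by auto
    show "emeasure (euclid s) (E i) \<le> ennreal (C * (case i of (j, m) \<Rightarrow> 2 ^ Suc j * real m powr (- v)))"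
    proof (cases "E (j, m) = {}")
      case False
      then obtain P where P: "(1 / 2) ^ Suc j \<le> ?n m P" "E (j, m) = slab s R (colerr a m P) (real m powr (- v))"
        using Ejm[OF i(2), of m] by blast
      have pos: "(0::real) < (1 / 2) ^ Suc j" by simp
      have "emeasure (euclid s) (E i) \<le> ennreal (C * real m powr (- v) / ?n m P)"
        unfolding i P C_def using R m less_le_trans[OF pos P(1)] by (intro slab_bound) auto
      also have "\<dots> \<le> ennreal (C * real m powr (- v) / (1 / 2) ^ Suc j)"
        using C P(1) pos less_le_trans[OF pos P(1)] by (intro ennreal_leI divide_left_mono mult_nonneg_nonneg mult_pos_pos) auto
      also have "C * real m powr (- v) / (1 / 2) ^ Suc j = C * (2 ^ Suc j * real m powr (- v))"
        by (simp add: power_one_over field_simps)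
      finally show ?thesis by (simp add: i)
    qed (simp add: i)
    show "0 \<le> C * (case i of (j, m) \<Rightarrow> 2 ^ Suc j * real m powr (- v))" using C by (simp add: i)
  qed auto
  then show "AE x in euclid s. x \<in> cbox_fun s R \<longrightarrow> finite {m. 1 \<le> m \<and> (\<exists>P. ?n m P < 1 / 2
    \<and> \<bar>aff s (colerr a m P) x\<bar> < real m powr (- v))}"
  proof (rule AE_mp, intro AE_I2 impI)
    fix x assume fin: "finite {i \<in> I. x \<in> E i}" and x: "x \<in> cbox_fun s R"
    have "{m. 1 \<le> m \<and> (\<exists>P. ?n m P < 1 / 2 \<and> \<bar>aff s (colerr a m P) x\<bar> < real m powr (- v))}
        \<subseteq> snd ` {i \<in> I. x \<in> E i}"
    proof
      fix m assume "m \<in> {m. 1 \<le> m \<and> (\<exists>P. ?n m P < 1 / 2 \<and> \<bar>aff s (colerr a m P) x\<bar> < real m powr (- v))}"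
      then obtain P where P: "1 \<le> m" "?n m P < 1 / 2" "\<bar>aff s (colerr a m P) x\<bar> < real m powr (- v)" by blast
      have "0 < c * real m powr (- w)" using c P(1) by simp
      then have "0 < ?n m P" using low[OF P(1), of P] by linarith
      then obtain j where j: "1 \<le> j" "(1 / 2) ^ Suc j \<le> ?n m P" "?n m P < (1 / 2) ^ j"
        using dyadic_scale[OF _ P(2)] by blast
      then have "(j, m) \<in> {i \<in> I. x \<in> E i}" using P x by (auto simp: I_def S_def E_def slab_def)
      then show "m \<in> snd ` {i \<in> I. x \<in> E i}" by force
    qed
    then show "finite {m. 1 \<le> m \<and> (\<exists>P. ?n m P < 1 / 2 \<and> \<bar>aff s (colerr a m P) x\<bar> < real m powr (- v))}"
      using finite_subset fin by blast
  qed
qed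

text \<open>Finiteness of the approximation set gives a lower bound \<open>low\<close> for all
  multipliers: outside the set directly, inside it through the positive error gap. Then
  \<open>q\<close> is reduced to the multiplier \<open>|q s|\<close>.\<close>

lemma AE_finite_near_column:
  assumes n: "n = s + 1" and w: "0 < w" "w < v" and v: "1 < v"
    and fin: "finite (approx_set (s + 1) 1 A w)"
  shows "AE x in euclid s. finite {q \<in> int_vecs n. \<exists>p. supnorm (s + 1) (resid s n A q p) < 1 / 2
      \<and> \<bar>aff s (resid s n A q p) x\<bar> < hgt n q powr (- v)}"
proof -
  let ?a = "\<lambda>i. A i 0"
  obtain d where d: "0 < d" "\<And>q p. q \<in> approx_set (s + 1) 1 A w \<Longrightarrow> d \<le> supnorm (s + 1) (err 1 A q p)"
    using approx_set_error_gap[OF _ _ fin] by auto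
  \<comment> \<open>The constant \<open>min d 1\<close> covers both cases, since
    \<open>real m powr (- w) \<le> 1\<close>.\<close>
  have low: "min d 1 * real m powr (- w) \<le> supnorm (s + 1) (colerr ?a m P)" if m: "1 \<le> m" for m P
  proof -
    let ?q = "\<lambda>j::nat. if j = 0 then int m else 0"
    have eq: "err 1 A ?q P = colerr ?a m P" by (simp add: err_def colerr_def)
    have h: "hgt 1 ?q = real m" unfolding supnorm_1 by simp
    have m1: "real m powr (- w) \<le> 1"
      using m w by (auto simp: powr_minus inverse_le_1_iff intro: ge_one_powr_ge_zero)
    show ?thesis
    proof (cases "?q \<in> approx_set (s + 1) 1 A w")
      case True
      have "min d 1 * real m powr (- w) \<le> d * 1" using d(1) m1 by (intro mult_mono) auto
      then show ?thesis using d(2)[OF True, of P] unfolding eq by linarith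
    next
      case False
      have "min d 1 * real m powr (- w) \<le> 1 * real m powr (- w)" by (intro mult_right_mono) auto
      moreover have "?q \<in> int_vecs 1" by (simp add: int_vecs_def)
      then have "real m powr (- w) \<le> supnorm (s + 1) (err 1 A ?q P)"
        using False unfolding approx_set_def mem_Collect_eq h by (meson not_less)
      ultimately show ?thesis unfolding eq by linarith
    qed
  qed
  have sn: "s < n" and n1: "n - s = 1" using n by auto
  have "AE x in euclid s. finite {m. 1 \<le> m \<and> (\<exists>P. supnorm (s + 1) (colerr ?a m P) < 1 / 2
    \<and> \<bar>aff s (colerr ?a m P) x\<bar> < real m powr (- v))}"
    using d(1) by (intro AE_finite_near_multiples[OF _ w v low]) auto
  then show ?thesis
  proof (rule AE_mp, intro AE_I2 impI)
    fix x
    let ?M = "{m. 1 \<le> m \<and> (\<exists>P. supnorm (s + 1) (colerr ?a m P) < 1 / 2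
      \<and> \<bar>aff s (colerr ?a m P) x\<bar> < real m powr (- v))}"
    let ?N = "{q \<in> int_vecs n. \<exists>p. supnorm (s + 1) (resid s n A q p) < 1 / 2
      \<and> \<bar>aff s (resid s n A q p) x\<bar> < hgt n q powr (- v)}"
    assume finM: "finite ?M"
    have "(\<lambda>q. q s) ` ?N \<subseteq> int ` ?M \<union> (\<lambda>m. - int m) ` ?M"
    proof (rule image_subsetI)
      fix q assume "q \<in> ?N"
      then obtain p where qn: "q \<in> int_vecs n" and near: "supnorm (s + 1) (resid s n A q p) < 1 / 2"
        and small: "\<bar>aff s (resid s n A q p) x\<bar> < hgt n q powr (- v)" by blast
      have "q \<noteq> (\<lambda>_. 0)" using small hgt_zero[of n] sn by auto
      then have "(\<lambda>j. q (s + j)) \<noteq> (\<lambda>_. 0)" by (rule near_tail_nonzero[OF sn qn _ near])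
      then obtain j where "q (s + j) \<noteq> 0" by blast
      then have qs: "q s \<noteq> 0" using qn n by (cases j) (auto simp: int_vecs_def)
      define m where "m = nat \<bar>q s\<bar>"
      have m1: "1 \<le> m" using qs by (simp add: m_def)
      have "\<bar>of_int (q s)\<bar> \<le> hgt n q" using n by (intro abs_le_supnorm) auto
      then have "real m \<le> hgt n q" by (simp add: m_def)
      then have le: "hgt n q powr (- v) \<le> real m powr (- v)" using m1 v by (intro powr_mono2') auto
      \<comment> \<open>Multiplying by the sign of \<open>q s\<close> makes the multiplier positive
        without changing the norm or the absolute value of the form.\<close>
      define P where "P = (\<lambda>i. sgn (q s) * case_nat p q i)"
      have rm: "real m = of_int (sgn (q s)) * of_int (q s)" by (auto simp: m_def sgn_if)
      have "colerr ?a m P = (\<lambda>i. of_int (sgn (q s)) * resid s n A q p i)"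
        unfolding colerr_def P_def resid_def err_def n1
        using rm by (auto simp: fun_eq_iff distrib_left mult_ac)
      moreover have "\<bar>real_of_int (sgn (q s))\<bar> = 1" using qs by (simp add: sgn_if)
      ultimately have "supnorm (s + 1) (colerr ?a m P) = supnorm (s + 1) (resid s n A q p)"
        "aff s (colerr ?a m P) x = of_int (sgn (q s)) * aff s (resid s n A q p) x"
        using supnorm_scale[of "s + 1" "of_int (sgn (q s))" "resid s n A q p"]
        by (auto simp: aff_def distrib_left sum_distrib_left mult_ac)
      then have "m \<in> ?M"
        using near small le m1 \<open>\<bar>real_of_int (sgn (q s))\<bar> = 1\<close> by (auto simp: abs_mult intro!: exI[of _ P])
      moreover have "q s = int m \<or> q s = - int m" by (auto simp: m_def)
      ultimately show "q s \<in> int ` ?M \<union> (\<lambda>m. - int m) ` ?M" by blast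
    qed
    then have "finite ((\<lambda>q. q s) ` ?N)" using finM finite_subset by blast
    \<comment> \<open>Since \<open>n = s + 1\<close>, the tail of \<open>q\<close> is the single
      entry \<open>q s\<close>, and uniqueness of small residuals applies.\<close>
    moreover have "inj_on (\<lambda>q. q s) ?N"
    proof (rule inj_onI)
      fix q q' assume q: "q \<in> ?N" "q' \<in> ?N" and eq: "q s = q' s"
      then obtain p p' where "supnorm (s + 1) (resid s n A q p) < 1 / 2" "supnorm (s + 1) (resid s n A q' p') < 1 / 2"
        by blast
      moreover have "q (s + j) = q' (s + j)" for j
        using q eq n by (cases j) (auto simp: int_vecs_def)
      ultimately show "q = q'" using sn q by (intro near_unique[of s n q q' A p p']) auto
    qed
    ultimately show "finite ?N" by (rule finite_imageD)
  qed
qed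

section \<open>The upper bound and the equality\<close>

lemma omega_mat_dependent_columns:
  assumes j: "j0 < l" "j1 < l" "j0 \<noteq> j1" and m: "0 < m"
    and r: "r \<in> \<rat>" "\<forall>i<m. A i j1 = r * A i j0"
  shows "omega_mat m l A = \<infinity>"
proof -
  obtain a b :: int where ab: "b > 0" "r = of_int a / of_int b" using r(1) by (metis Rats_cases')
  \<comment> \<open>With \<open>r = a / b\<close>, \<open>b\<close> times column \<open>j1\<close>
    equals \<open>a\<close> times column \<open>j0\<close>; the vector is nonzero since
    \<open>b > 0\<close>, even for \<open>r = 0\<close>.\<close>
  let ?q = "\<lambda>j. if j = j1 then b else if j = j0 then - a else 0"
  have "err l A ?q (\<lambda>_. 0) i = 0" if "i < m" for i
  proof -
    have "(\<Sum>j<l. A i j * of_int (?q j)) = (\<Sum>j\<in>{j0, j1}. A i j * of_int (?q j))"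
      using j by (intro sum.mono_neutral_right) auto
    also have "\<dots> = 0" using j ab r(2) that by (simp add: field_simps)
    finally show ?thesis by (simp add: err_def)
  qed
  moreover have "?q \<in> int_vecs l" using j by (auto simp: int_vecs_def)
  moreover have "?q \<noteq> (\<lambda>_. 0)" using ab(1) by (auto dest: fun_cong[of _ _ j1])
  ultimately show ?thesis using m j by (intro omega_mat_infinity_of_relation[of m l ?q]) auto
qed

text \<open>If \<open>u \<ge> v\<close>, an exponent above \<open>u\<close> at \<open>x\<close>
  would give infinitely many approximations of exponent \<open>v\<close>, which happens only on a
  null set.\<close>

lemma omega_L_measure_le:
  assumes sn: "s < n" and v: "0 < v"
    and AE: "AE x in euclid s. finite (approx_set 1 n (\<lambda>i. Lmap s n A x) v)"
    and u: "emeasure (L_measure s n A) {y \<in> space (L_measure s n A). omega_vec n y > ereal u} > 0"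
  shows "u < v"
proof (rule ccontr)
  assume "\<not> u < v"
  let ?E = "{y \<in> space (L_measure s n A). ereal u < omega_vec n y}"
  have null: "AE x in euclid s. \<not> ereal u < omega_vec n (Lmap s n A x)"
    using AE
  proof (rule AE_mp, intro AE_I2 impI notI)
    fix x assume fin: "finite (approx_set 1 n (\<lambda>i. Lmap s n A x) v)"
      and gt: "ereal u < omega_vec n (Lmap s n A x)"
    obtain v' where "u < v'" "infinite (approx_set 1 n (\<lambda>i. Lmap s n A x) v')"
      using gt omega_mat_less_iff[of 1 n u] sn v \<open>\<not> u < v\<close> unfolding omega_vec_def by auto
    moreover have "approx_set 1 n (\<lambda>i. Lmap s n A x) v' \<subseteq> approx_set 1 n (\<lambda>i. Lmap s n A x) v"
      using sn \<open>\<not> u < v\<close> \<open>u < v'\<close> by (intro approx_set_antimono) auto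
    ultimately show False using fin finite_subset by blast
  qed
  \<comment> \<open>Positive measure implies measurability, as \<open>emeasure\<close> vanishes
    outside \<open>sets\<close>.\<close>
  have sets: "?E \<in> sets (L_measure s n A)" using u by (metis emeasure_neq_0_sets less_irrefl)
  then have "emeasure (L_measure s n A) ?E = emeasure (euclid s) (Lmap s n A -` ?E \<inter> space (euclid s))"
    unfolding L_measure_def by (intro emeasure_distr measurable_Lmap) simp
  also have "\<dots> = emeasure (euclid s) {}"
  proof (rule emeasure_eq_AE)
    show "AE x in euclid s. x \<in> Lmap s n A -` ?E \<inter> space (euclid s) \<longleftrightarrow> x \<in> {}"
      using null by eventually_elim auto
    show "Lmap s n A -` ?E \<inter> space (euclid s) \<in> sets (euclid s)"
      using sets measurable_Lmap[of s n A] by (intro measurable_sets) (auto simp: L_measure_def)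
  qed auto
  finally show False using u by simp
qed

theorem theorem0p4:
  fixes s n :: nat and A :: "nat \<Rightarrow> nat \<Rightarrow> real"
  assumes "s \<le> n - 1" and "n \<ge> 1"
  assumes "(\<exists>j0<n - s. \<forall>j<n - s. \<exists>r\<in>\<rat>. \<forall>i<s + 1. A i j = r * A i j0)
         \<or> (\<exists>i0<s + 1. \<forall>i<s + 1. \<exists>r\<in>\<rat>. \<forall>j<n - s. A i j = r * A i0 j)"
  shows "omega_measure n (L_measure s n A) = max (omega_mat (s + 1) (n - s) A) (ereal (real n))"
proof (rule antisym)
  have sn: "s < n" using assms by simp
  show "max (omega_mat (s + 1) (n - s) A) (ereal (real n)) \<le> omega_measure n (L_measure s n A)"
    using sn by (rule omega_L_measure_lower)
  show "omega_measure n (L_measure s n A) \<le> max (omega_mat (s + 1) (n - s) A) (ereal (real n))"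
    unfolding omega_measure_def
  proof (rule Sup_least, clarify)
    fix u assume u: "emeasure (L_measure s n A) {y \<in> space (L_measure s n A). omega_vec n y > ereal u} > 0"
    show "ereal u \<le> max (omega_mat (s + 1) (n - s) A) (ereal (real n))"
    proof (rule ccontr)
      assume "\<not> ?thesis"
      then have gt: "max (omega_mat (s + 1) (n - s) A) (ereal (real n)) < ereal u" by (simp only: not_le)
      \<comment> \<open>The intermediate \<open>w\<close> splits the margin: the approximation set
        at \<open>w\<close> is finite, while the slabs are taken with the larger exponent
        \<open>u\<close>.\<close>
      obtain w where w: "max (omega_mat (s + 1) (n - s) A) (ereal (real n)) < ereal w" "w < u"
        using ereal_dense2[OF gt] by auto
      then have wn: "real n < w" and wA: "omega_mat (s + 1) (n - s) A < ereal w" by auto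
      have fin: "finite (approx_set (s + 1) (n - s) A w)"
        using omega_mat_geI[of w "s + 1" "n - s" A] wA wn by (auto simp: not_le[symmetric])
      have "\<exists>e>0. AE x in euclid s. finite {q \<in> int_vecs n. \<exists>p. supnorm (s + 1) (resid s n A q p) < e
        \<and> \<bar>aff s (resid s n A q p) x\<bar> < hgt n q powr (- u)}"
        using assms(3)
      proof
        assume "\<exists>j0<n - s. \<forall>j<n - s. \<exists>r\<in>\<rat>. \<forall>i<s + 1. A i j = r * A i j0"
        then obtain j0 where j0: "j0 < n - s" "\<forall>j<n - s. \<exists>r\<in>\<rat>. \<forall>i<s + 1. A i j = r * A i j0" by blast
        \<comment> \<open>Two columns with a rational ratio would make \<open>omega_mat\<close>
          infinite, against its bound by \<open>w\<close>.\<close>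
        have "n = s + 1"
        proof (rule ccontr)
          assume "n \<noteq> s + 1"
          then obtain j1 where j1: "j1 < n - s" "j1 \<noteq> j0"
            using sn by (metis One_nat_def Suc_lessI add.commute add_diff_inverse_nat j0(1) less_Suc0
                not_less_iff_gr_or_eq plus_1_eq_Suc zero_less_diff)
          then obtain r where "r \<in> \<rat>" "\<forall>i<s + 1. A i j1 = r * A i j0" using j0(2) by blast
          then have "omega_mat (s + 1) (n - s) A = \<infinity>"
            using j0 j1 by (intro omega_mat_dependent_columns[of j0 _ j1 _ r]) auto
          then show False using wA by simp
        qed
        then show ?thesis
          using AE_finite_near_column[of n s w u A] w wn fin by (intro exI[of _ "1 / 2"]) auto
      next
        assume "\<exists>i0<s + 1. \<forall>i<s + 1. \<exists>r\<in>\<rat>. \<forall>j<n - s. A i j = r * A i0 j"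
        then obtain i0 r where i0: "i0 < s + 1"
          and r: "\<And>i. i < s + 1 \<Longrightarrow> r i \<in> \<rat> \<and> (\<forall>j<n - s. A i j = r i * A i0 j)" by metis
        \<comment> \<open>If row \<open>i0\<close> vanishes, the chosen \<open>r i0\<close> may
          differ from 1; resetting it to 1 keeps the relation.\<close>
        show ?thesis
        proof (rule AE_finite_near_rows[OF sn _ i0 _ _ fin \<open>w < u\<close>, of "r(i0 := 1)"])
          show "\<forall>i<s + 1. (r(i0 := 1)) i \<in> \<rat>" "(r(i0 := 1)) i0 = 1" "0 \<le> u"
            using r w wn by (simp_all split: if_split)
          show "\<forall>i<s + 1. \<forall>j<n - s. A i j = (r(i0 := 1)) i * A i0 j"
          proof (intro allI impI)
            fix i j assume "i < s + 1" "j < n - s"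
            then show "A i j = (r(i0 := 1)) i * A i0 j"
              using r[of i] by (cases "i = i0") (simp, metis fun_upd_other)
          qed
        qed blast
      qed
      then obtain e where e: "0 < e" and near:
        "AE x in euclid s. finite {q \<in> int_vecs n. \<exists>p. supnorm (s + 1) (resid s n A q p) < e
          \<and> \<bar>aff s (resid s n A q p) x\<bar> < hgt n q powr (- u)}" by blast
      have far: "AE x in euclid s. finite {q \<in> int_vecs n. \<exists>p. e \<le> supnorm (s + 1) (resid s n A q p)
          \<and> \<bar>aff s (resid s n A q p) x\<bar> < hgt n q powr (- u)}"
        using w wn e by (intro AE_finite_far[OF sn]) auto
      have "AE x in euclid s. finite (approx_set 1 n (\<lambda>i. Lmap s n A x) u)"
        using near far
      proof eventually_elim
        case (elim x)
        then have "finite ({q \<in> int_vecs n. \<exists>p. supnorm (s + 1) (resid s n A q p) < e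
          \<and> \<bar>aff s (resid s n A q p) x\<bar> < hgt n q powr (- u)}
          \<union> {q \<in> int_vecs n. \<exists>p. e \<le> supnorm (s + 1) (resid s n A q p)
          \<and> \<bar>aff s (resid s n A q p) x\<bar> < hgt n q powr (- u)})" by (rule finite_UnI)
        then show ?case
        proof (rule finite_subset[rotated], intro subsetI)
          fix q assume "q \<in> approx_set 1 n (\<lambda>i. Lmap s n A x) u"
          then obtain p where "q \<in> int_vecs n" "\<bar>aff s (resid s n A q p) x\<bar> < hgt n q powr (- u)"
            unfolding approx_set_Lmap[OF sn] by blast
          moreover have "supnorm (s + 1) (resid s n A q p) < e \<or> e \<le> supnorm (s + 1) (resid s n A q p)"
            by linarith
          ultimately show "q \<in> {q \<in> int_vecs n. \<exists>p. supnorm (s + 1) (resid s n A q p) < e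
            \<and> \<bar>aff s (resid s n A q p) x\<bar> < hgt n q powr (- u)}
            \<union> {q \<in> int_vecs n. \<exists>p. e \<le> supnorm (s + 1) (resid s n A q p)
            \<and> \<bar>aff s (resid s n A q p) x\<bar> < hgt n q powr (- u)}"
            by blast
        qed
      qed
      moreover have "0 < u" using w(2) wn by simp
      ultimately have "u < u" using u by (intro omega_L_measure_le[OF sn, of u A u])
      then show False by simp
    qed
  qed
qed

end
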